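(* The problem \textsf{BI} is polynomial-time many-one reducible to the problem \textsf{GRIS}.
   Context: All groups are finite. For finite Abelian groups $A, B$ and a bilinear map $f : B \times B \to A$ (bilinear when $A,B$ are regarded as $\mathbb{Z}$-modules), an isometry of $f$ is an automorphism $\beta \in \mathrm{Aut}(B)$ with $f(x,y) = f(\beta x, \beta y)$ for all $x, y \in B$; the isometries form a group. \textsf{BI}: given finite Abelian groups $A$ and $B$ and a bilinear map $f : B \times B \to A$ given as a table of all values $f(x,y)$, $x,y \in B$, compute the isometry group of $f$. \textsf{GRIS}: given finite groups $G$ and $H$ by their multiplication tables and a coset $\sigma\Gamma$ of bijections from $G$ to $H$ (given by a representative and generators of a permutation group), compute all group isomorphisms from $G$ to $H$ that lie in $\sigma\Gamma$. *)

theory Defs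
  imports "HOL-Computational_Algebra.Polynomial" "HOL-Algebra.Bij" "HOL-Algebra.Generated_Groups"
begin

section \<open>Polynomial time on multitape Turing machines\<close>

type_synonym word = "bool list"

datatype move = MoveLeft | Stay | MoveRight

text \<open>
  A deterministic machine with \<open>tapes\<close> two-way infinite tapes, the tape alphabet
  \<open>{..<syms}\<close> and the states \<open>{..states}\<close>. The start state is 0 and the unique halting
  state is \<open>states\<close>. Symbol 0 is the blank, the bits are written as 1 and 2.
\<close>

record tm =
  tapes :: nat
  syms :: nat
  states :: nat
  delta :: "nat \<Rightarrow> nat list \<Rightarrow> nat \<times> (nat \<times> move) list"

definition wf_tm :: "tm \<Rightarrow> bool" where
  "wf_tm M \<longleftrightarrow> 2 \<le> tapes M \<and> 3 \<le> syms M \<and>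
     (\<forall>q rs. q < states M \<and> length rs = tapes M \<and> set rs \<subseteq> {..<syms M} \<longrightarrow>
        fst (delta M q rs) \<le> states M \<and>
        length (snd (delta M q rs)) = tapes M \<and>
        fst ` set (snd (delta M q rs)) \<subseteq> {..<syms M})"

text \<open>A tape consists of its contents and the position of the head.\<close>

type_synonym tape = "(int \<Rightarrow> nat) \<times> int"
type_synonym config = "nat \<times> tape list"

definition read_tape :: "tape \<Rightarrow> nat" where
  "read_tape tp = fst tp (snd tp)"

fun shift :: "move \<Rightarrow> int \<Rightarrow> int" where
  "shift MoveLeft i = i - 1"
| "shift Stay i = i"
| "shift MoveRight i = i + 1"

definition act_tape :: "nat \<times> move \<Rightarrow> tape \<Rightarrow> tape" where
  "act_tape a tp = ((fst tp)(snd tp := fst a), shift (snd a) (snd tp))"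

definition tm_step :: "tm \<Rightarrow> config \<Rightarrow> config" where
  "tm_step M c =
     (if fst c < states M
      then (case delta M (fst c) (map read_tape (snd c)) of
              (q, as) \<Rightarrow> (q, map2 act_tape as (snd c)))
      else c)"

definition word_contents :: "word \<Rightarrow> int \<Rightarrow> nat" where
  "word_contents w i =
     (if 0 \<le> i \<and> nat i < length w then (if w ! nat i then 2 else 1) else 0)"

text \<open>The input is on tape 0, all other tapes are blank, and all heads are at position 0.\<close>

definition tm_init :: "tm \<Rightarrow> word \<Rightarrow> config" where
  "tm_init M w = (0, (word_contents w, 0) # replicate (tapes M - 1) (word_contents [], 0))"

text \<open>The output is the contents of tape 1 at the time of halting.\<close>

definition tm_computes_within :: "tm \<Rightarrow> word \<Rightarrow> word \<Rightarrow> nat \<Rightarrow> bool" where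
  "tm_computes_within M w v T \<longleftrightarrow>
     (\<exists>t\<le>T. case (tm_step M ^^ t) (tm_init M w) of
        (q, tps) \<Rightarrow> q = states M \<and> fst (tps ! 1) = word_contents v)"

text \<open>
  A function on a set \<open>D\<close> of objects is computed on their encodings; the machine is not
  constrained on words that do not encode an element of \<open>D\<close>.
\<close>

definition polytime_on ::
    "('a \<Rightarrow> word) \<Rightarrow> ('b \<Rightarrow> word) \<Rightarrow> 'a set \<Rightarrow> ('a \<Rightarrow> 'b) \<Rightarrow> bool" where
  "polytime_on ea eb D f \<longleftrightarrow>
     (\<exists>M (p :: nat poly). wf_tm M \<and>
        (\<forall>x\<in>D. tm_computes_within M (ea x) (eb (f x)) (poly p (length (ea x)))))"


section \<open>Encodings\<close>

text \<open>
  Numbers are written in unary. The numbers occurring below are elements of groups given by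
  their multiplication tables, so they are smaller than the length of the table and the choice
  of unary or binary notation changes lengths only by a polynomial. All the encodings are
  self-delimiting, so that pairs are encoded by concatenation.
\<close>

definition enc_nat :: "nat \<Rightarrow> word" where
  "enc_nat n = replicate n True @ [False]"

primrec enc_list :: "('a \<Rightarrow> word) \<Rightarrow> 'a list \<Rightarrow> word" where
  "enc_list e [] = [False]"
| "enc_list e (x # xs) = True # e x @ enc_list e xs"

primrec enc_option :: "('a \<Rightarrow> word) \<Rightarrow> 'a option \<Rightarrow> word" where
  "enc_option e None = [False]"
| "enc_option e (Some x) = True # e x"

definition enc_pair :: "('a \<Rightarrow> word) \<Rightarrow> ('b \<Rightarrow> word) \<Rightarrow> 'a \<times> 'b \<Rightarrow> word" where
  "enc_pair ea eb xy = ea (fst xy) @ eb (snd xy)"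

definition self_delimiting :: "('a \<Rightarrow> word) \<Rightarrow> bool" where
  "self_delimiting e \<longleftrightarrow> (\<forall>x y u v. e x @ u = e y @ v \<longrightarrow> x = y \<and> u = v)"

lemma self_delimiting_inj: "self_delimiting e \<Longrightarrow> inj e"
  unfolding self_delimiting_def inj_def by (metis append_Nil2)

lemma self_delimiting_nat: "self_delimiting enc_nat"
proof -
  have "m = n \<and> u = v" if "enc_nat m @ u = enc_nat n @ v" for m n u v
    using that
  proof (induction m arbitrary: n)
    case 0
    then show ?case by (cases n) (auto simp: enc_nat_def)
  next
    case (Suc m)
    then show ?case by (cases n) (auto simp: enc_nat_def)
  qed
  then show ?thesis unfolding self_delimiting_def by blast
qed

lemma self_delimiting_list:
  assumes "self_delimiting e"
  shows "self_delimiting (enc_list e)"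
proof -
  have "xs = ys \<and> u = v" if "enc_list e xs @ u = enc_list e ys @ v" for xs ys u v
    using that
  proof (induction xs arbitrary: ys)
    case Nil
    then show ?case by (cases ys) auto
  next
    case (Cons x xs)
    then obtain y ys' where ys: "ys = y # ys'" by (cases ys) auto
    with Cons.prems have "e x @ enc_list e xs @ u = e y @ enc_list e ys' @ v" by simp
    with assms have "x = y" "enc_list e xs @ u = enc_list e ys' @ v"
      unfolding self_delimiting_def by blast+
    with Cons.IH ys show ?case by blast
  qed
  then show ?thesis unfolding self_delimiting_def by blast
qed

lemma self_delimiting_option:
  assumes "self_delimiting e"
  shows "self_delimiting (enc_option e)"
  unfolding self_delimiting_def
proof (intro allI impI)
  fix x y u v
  assume "enc_option e x @ u = enc_option e y @ v"
  with assms show "x = y \<and> u = v"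
    unfolding self_delimiting_def by (cases x; cases y) auto
qed

lemma self_delimiting_pair:
  assumes "self_delimiting ea" "self_delimiting eb"
  shows "self_delimiting (enc_pair ea eb)"
  unfolding self_delimiting_def
proof (intro allI impI)
  fix x y :: "'a \<times> 'b" and u v
  assume "enc_pair ea eb x @ u = enc_pair ea eb y @ v"
  then have "ea (fst x) @ eb (snd x) @ u = ea (fst y) @ eb (snd y) @ v"
    by (simp add: enc_pair_def)
  with assms(1) have "fst x = fst y" "eb (snd x) @ u = eb (snd y) @ v"
    unfolding self_delimiting_def by blast+
  moreover from this(2) assms(2) have "snd x = snd y" "u = v"
    unfolding self_delimiting_def by blast+
  ultimately show "x = y \<and> u = v" by (simp add: prod_eq_iff)
qed


section \<open>Computational problems and many-one reductions\<close>

record ('i, 's) problem =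
  instances :: "'i set"
  solutions :: "'i \<Rightarrow> 's set"
  enc_inst :: "'i \<Rightarrow> word"
  enc_sol :: "'s \<Rightarrow> word"

text \<open>
  For problems that ask for an object rather than for a yes/no answer, a many-one reduction
  maps every instance \<open>x\<close> to a single instance \<open>F x\<close>, together with a map \<open>R\<close> that recovers
  a solution of \<open>x\<close> from \<open>x\<close> and an arbitrary solution of \<open>F x\<close>.
\<close>

definition poly_many_one_reducible :: "('i, 's) problem \<Rightarrow> ('j, 't) problem \<Rightarrow> bool" where
  "poly_many_one_reducible P Q \<longleftrightarrow>
     (\<exists>F R.
        polytime_on (enc_inst P) (enc_inst Q) (instances P) F \<and>
        polytime_on (enc_pair (enc_inst P) (enc_sol Q)) (enc_sol P)
          {(x, s). x \<in> instances P \<and> s \<in> solutions Q (F x)} R \<and>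
        (\<forall>x\<in>instances P. F x \<in> instances Q \<and>
           (\<forall>s\<in>solutions Q (F x). R (x, s) \<in> solutions P x)))"


section \<open>Groups and permutations given by tables\<close>

type_synonym table = "nat list list"

text \<open>For a table of a group, the choice of the unit is forced.\<close>

definition table_group :: "table \<Rightarrow> nat monoid" where
  "table_group T =
     \<lparr>carrier = {..<length T},
      mult = (\<lambda>x y. T ! x ! y),
      one = (THE e. e < length T \<and> (\<forall>x<length T. T ! e ! x = x \<and> T ! x ! e = x))\<rparr>"

definition is_group_table :: "table \<Rightarrow> bool" where
  "is_group_table T \<longleftrightarrow> (\<forall>r\<in>set T. length r = length T) \<and> group (table_group T)"

definition list_fun :: "nat list \<Rightarrow> nat \<Rightarrow> nat" where
  "list_fun p = restrict (\<lambda>i. p ! i) {..<length p}"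

definition is_perm_list :: "nat \<Rightarrow> nat list \<Rightarrow> bool" where
  "is_perm_list n p \<longleftrightarrow> length p = n \<and> list_fun p \<in> Bij {..<n}"

definition generated_perms :: "nat \<Rightarrow> nat list list \<Rightarrow> (nat \<Rightarrow> nat) set" where
  "generated_perms n ps = generate (BijGroup {..<n}) (list_fun ` set ps)"


section \<open>Isometry groups of bilinear maps\<close>

text \<open>The groups are written multiplicatively; the third condition is linearity over the integers.\<close>

definition bilinear_map :: "('b, 'm) monoid_scheme \<Rightarrow> ('a, 'n) monoid_scheme \<Rightarrow> ('b \<Rightarrow> 'b \<Rightarrow> 'a) \<Rightarrow> bool" where
  "bilinear_map B A f \<longleftrightarrow>
     (\<forall>x\<in>carrier B. \<forall>y\<in>carrier B. f x y \<in> carrier A) \<and>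
     (\<forall>x\<in>carrier B. \<forall>x'\<in>carrier B. \<forall>y\<in>carrier B.
        f (x \<otimes>\<^bsub>B\<^esub> x') y = f x y \<otimes>\<^bsub>A\<^esub> f x' y \<and>
        f y (x \<otimes>\<^bsub>B\<^esub> x') = f y x \<otimes>\<^bsub>A\<^esub> f y x') \<and>
     (\<forall>k :: int. \<forall>x\<in>carrier B. \<forall>y\<in>carrier B.
        f (x [^]\<^bsub>B\<^esub> k) y = f x y [^]\<^bsub>A\<^esub> k \<and>
        f x (y [^]\<^bsub>B\<^esub> k) = f x y [^]\<^bsub>A\<^esub> k)"

definition isometries :: "('b, 'm) monoid_scheme \<Rightarrow> ('b \<Rightarrow> 'b \<Rightarrow> 'a) \<Rightarrow> ('b \<Rightarrow> 'b) set" where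
  "isometries B f = {\<beta> \<in> auto B. \<forall>x\<in>carrier B. \<forall>y\<in>carrier B. f x y = f (\<beta> x) (\<beta> y)}"

text \<open>
  An instance \<open>(A, B, f)\<close> consists of the tables of both groups and of the bilinear map; a solution
  is a list of generators of the isometry group, each given by its list of values.
\<close>

type_synonym bi_inst = "table \<times> table \<times> table"

definition BI_instances :: "bi_inst set" where
  "BI_instances = {(A, B, f).
     is_group_table A \<and> comm_group (table_group A) \<and>
     is_group_table B \<and> comm_group (table_group B) \<and>
     length f = length B \<and> (\<forall>r\<in>set f. length r = length B) \<and>
     bilinear_map (table_group B) (table_group A) (\<lambda>x y. f ! x ! y)}"

definition BI_solutions :: "bi_inst \<Rightarrow> nat list list set" where
  "BI_solutions = (\<lambda>(A, B, f). {ps.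
     (\<forall>p\<in>set ps. is_perm_list (length B) p) \<and>
     generated_perms (length B) ps = isometries (table_group B) (\<lambda>x y. f ! x ! y)})"

definition BI :: "(bi_inst, nat list list) problem" where
  "BI = \<lparr>instances = BI_instances,
         solutions = BI_solutions,
         enc_inst = (let e = enc_list (enc_list enc_nat) in enc_pair e (enc_pair e e)),
         enc_sol = enc_list (enc_list enc_nat)\<rparr>"


section \<open>Group isomorphisms in a coset of bijections\<close>

text \<open>
  The coset of the bijection given by \<open>s\<close> and the permutation group on \<open>{..<n}\<close> generated by
  \<open>ps\<close>; permutations act on the left, so the permutation is applied first.
\<close>

definition list_coset :: "nat \<Rightarrow> nat list \<Rightarrow> nat list list \<Rightarrow> (nat \<Rightarrow> nat) set" where
  "list_coset n s ps = (\<lambda>\<gamma>. compose {..<n} (list_fun s) \<gamma>) ` generated_perms n ps"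

type_synonym gris_inst = "table \<times> table \<times> nat list \<times> nat list list"

definition GRIS_instances :: "gris_inst set" where
  "GRIS_instances = {(G, H, s, ps).
     is_group_table G \<and> is_group_table H \<and>
     length s = length G \<and> bij_betw (list_fun s) {..<length G} {..<length H} \<and>
     (\<forall>p\<in>set ps. is_perm_list (length G) p)}"

text \<open>
  The isomorphisms in the coset are either none at all or again a coset of a permutation group,
  and in the latter case they are output by a representative and generators.
\<close>

definition GRIS_solutions :: "gris_inst \<Rightarrow> (nat list \<times> nat list list) option set" where
  "GRIS_solutions = (\<lambda>(G, H, s, ps).
     let I = iso (table_group G) (table_group H) \<inter> list_coset (length G) s ps
     in if I = {} then {None}
        else {Some (t, qs) | t qs. length t = length G \<and>
                (\<forall>q\<in>set qs. is_perm_list (length G) q) \<and> list_coset (length G) t qs = I})"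

definition GRIS :: "(gris_inst, (nat list \<times> nat list list) option) problem" where
  "GRIS = \<lparr>instances = GRIS_instances,
           solutions = GRIS_solutions,
           enc_inst = (let e = enc_list (enc_list enc_nat)
                       in enc_pair e (enc_pair e (enc_pair (enc_list enc_nat) e))),
           enc_sol = enc_option (enc_pair (enc_list enc_nat) (enc_list (enc_list enc_nat)))\<rparr>"


lemma inj_encodings:
  "inj (enc_inst BI)" "inj (enc_sol BI)" "inj (enc_inst GRIS)" "inj (enc_sol GRIS)"
  unfolding BI_def GRIS_def Let_def problem.simps
  by (intro self_delimiting_inj self_delimiting_pair self_delimiting_option
      self_delimiting_list self_delimiting_nat)+

section \<open>Every instance has a solution\<close>

lemma subgroup_has_generators:
  assumes "subgroup S (BijGroup {..<n})"
  obtains ps where "\<forall>p\<in>set ps. is_perm_list n p" "generated_perms n ps = S"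
proof -
  interpret Sym: group "BijGroup {..<n}" by (rule group_BijGroup)
  define l where "l f = map f [0..<n]" for f :: "nat \<Rightarrow> nat"
  have SB: "S \<subseteq> Bij {..<n}"
    using subgroup.subset[OF assms] by (simp add: BijGroup_def)
  have l: "list_fun (l f) = f" if "f \<in> S" for f
  proof
    fix i
    have "f \<in> Bij {..<n}" using that SB by (rule rev_subsetD)
    then have "f i = undefined" if "\<not> i < n"
      using that by (intro extensional_arb[OF Bij_imp_extensional, of f "{..<n}" i]) simp_all
    then show "list_fun (l f) i = f i"
      by (cases "i < n") (simp_all add: list_fun_def l_def)
  qed
  have "f \<in> {..<n} \<rightarrow>\<^sub>E {..<n}" if "f \<in> S" for f
    using Bij_imp_funcset[of f] Bij_imp_extensional[of f] that SB unfolding PiE_def by blast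
  then have "S \<subseteq> {..<n} \<rightarrow>\<^sub>E {..<n}" by blast
  then have "finite S"
    using finite_PiE[of "{..<n}" "\<lambda>_. {..<n}"] finite_subset by blast
  then obtain fs where fs: "set fs = S" using finite_list by blast
  have "list_fun ` set (map l fs) = S"
    using l by (simp add: fs image_image)
  then have "generated_perms n (map l fs) = generate (BijGroup {..<n}) S"
    by (simp only: generated_perms_def)
  also have "\<dots> = S"
    using Sym.generate_subgroup_incl[OF _ assms, of S] generate.incl[of _ S "BijGroup {..<n}"]
    by blast
  finally have "generated_perms n (map l fs) = S" .
  moreover have "\<forall>p\<in>set (map l fs). is_perm_list n p"
  proof
    fix p assume "p \<in> set (map l fs)"
    then obtain f where "f \<in> S" "p = l f" using fs by auto
    then show "is_perm_list n p"
      using l SB by (auto simp: is_perm_list_def) (simp add: l_def)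
  qed
  ultimately show thesis using that by blast
qed

lemma BI_solutions_nonempty:
  assumes "x \<in> BI_instances"
  shows "BI_solutions x \<noteq> {}"
proof -
  obtain A B f where x: "x = (A, B, f)" by (cases x)
  let ?B = "table_group B" and ?f = "\<lambda>x y. f ! x ! y"
  from assms x have "group ?B" by (auto simp: BI_instances_def is_group_table_def)
  then interpret B: group ?B .
  have cB: "carrier ?B = {..<length B}" by (simp add: table_group_def)
  interpret Sym: group "BijGroup (carrier ?B)" by (rule group_BijGroup)
  have aut: "auto ?B \<subseteq> Bij (carrier ?B)" by (auto simp: auto_def)
  have "subgroup (isometries ?B ?f) (BijGroup (carrier ?B))"
  proof (rule Sym.subgroupI)
    show "isometries ?B ?f \<subseteq> carrier (BijGroup (carrier ?B))"
      using aut by (auto simp: isometries_def BijGroup_def)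
    show "isometries ?B ?f \<noteq> {}"
      using B.id_in_auto by (auto simp: isometries_def)
  next
    fix a assume a: "a \<in> isometries ?B ?f"
    then have aB: "a \<in> Bij (carrier ?B)" and aa: "a \<in> auto ?B"
      using aut by (auto simp: isometries_def)
    let ?b = "inv\<^bsub>BijGroup (carrier ?B)\<^esub> a"
    have b: "?b = (\<lambda>x\<in>carrier ?B. inv_into (carrier ?B) a x)" by (rule inv_BijGroup[OF aB])
    have "?b \<in> auto ?B"
      using subgroup.m_inv_closed[OF B.subgroup_auto aa] .
    moreover have "?f x y = ?f (?b x) (?b y)" if xy: "x \<in> carrier ?B" "y \<in> carrier ?B" for x y
    proof -
      have im: "a ` carrier ?B = carrier ?B" using aB by (simp add: Bij_def bij_betw_def)
      have "?b x \<in> carrier ?B" "?b y \<in> carrier ?B" "a (?b x) = x" "a (?b y) = y"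
        using xy im unfolding b by (auto simp: f_inv_into_f inv_into_into)
      with a show ?thesis by (auto simp: isometries_def)
    qed
    ultimately show "?b \<in> isometries ?B ?f" by (auto simp: isometries_def)
  next
    fix a b assume ab: "a \<in> isometries ?B ?f" "b \<in> isometries ?B ?f"
    then have B: "a \<in> Bij (carrier ?B)" "b \<in> Bij (carrier ?B)"
      and "a \<in> auto ?B" "b \<in> auto ?B"
      using aut by (auto simp: isometries_def)
    then have "a \<otimes>\<^bsub>BijGroup (carrier ?B)\<^esub> b \<in> auto ?B"
      by (intro subgroup.m_closed[OF B.subgroup_auto])
    moreover have "a \<otimes>\<^bsub>BijGroup (carrier ?B)\<^esub> b = compose (carrier ?B) a b"
      using B by (simp add: BijGroup_def)
    moreover have "b x \<in> carrier ?B" if "x \<in> carrier ?B" for x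
      using B(2) that Bij_imp_funcset by blast
    ultimately show "a \<otimes>\<^bsub>BijGroup (carrier ?B)\<^esub> b \<in> isometries ?B ?f"
      using ab by (simp add: isometries_def compose_eq)
  qed
  then obtain ps where "\<forall>p\<in>set ps. is_perm_list (length B) p"
    "generated_perms (length B) ps = isometries ?B ?f"
    using subgroup_has_generators unfolding cB by blast
  then show ?thesis by (auto simp: BI_solutions_def x)
qed

lemma GRIS_solutions_nonempty:
  assumes "x \<in> GRIS_instances"
  shows "GRIS_solutions x \<noteq> {}"
proof -
  obtain G H s ps where x: "x = (G, H, s, ps)" by (cases x) auto
  let ?G = "table_group G" and ?H = "table_group H" and ?n = "length G"
  define X where "X = {..<?n}"
  define I where "I = iso ?G ?H \<inter> list_coset ?n s ps"
  define P where "P = generated_perms ?n ps"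
  from assms x have "group ?G" and ps: "\<forall>p\<in>set ps. is_perm_list ?n p"
    by (auto simp: GRIS_instances_def is_group_table_def)
  then interpret G: group ?G by simp
  have cG: "carrier ?G = X" by (simp add: table_group_def X_def)
  interpret Sym: group "BijGroup X" by (rule group_BijGroup)
  have P: "subgroup P (BijGroup X)"
    unfolding P_def generated_perms_def X_def[symmetric]
    using ps by (intro Sym.generate_is_subgroup) (auto simp: BijGroup_def is_perm_list_def X_def)
  have PB: "P \<subseteq> Bij X" using subgroup.subset[OF P] by (simp add: BijGroup_def)
  show ?thesis
  proof (cases "I = {}")
    case True
    then show ?thesis by (simp add: GRIS_solutions_def x I_def)
  next
    case False
    then obtain t where tI: "t \<in> I" by blast
    then obtain g where g: "g \<in> P" "t = compose X (list_fun s) g"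
      by (auto simp: I_def list_coset_def P_def X_def)
    have t: "t \<in> iso ?G ?H" using tI by (simp add: I_def)
    define ts where "ts = map t [0..<?n]"
    have ts: "list_fun ts = t"
      using g(2) by (auto simp: list_fun_def ts_def restrict_def compose_def X_def)
    have "subgroup (P \<inter> auto ?G) (BijGroup X)"
      using P G.subgroup_auto Sym.subgroups_Inter_pair unfolding cG by blast
    then obtain qs where qs: "\<forall>q\<in>set qs. is_perm_list ?n q"
      "generated_perms ?n qs = P \<inter> auto ?G"
      using subgroup_has_generators unfolding X_def by blast
    have mult: "a \<otimes>\<^bsub>BijGroup X\<^esub> b = compose X a b" if "a \<in> P" "b \<in> P" for a b
      using that PB by (auto simp: BijGroup_def)
    have maps: "a y \<in> X" if "a \<in> P" "y \<in> X" for a y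
      using that PB Bij_imp_funcset by blast
    have tinj: "inj_on t X" using t by (auto simp: iso_def bij_betw_def cG)
    have "list_coset ?n ts qs = I"
    proof (intro equalityI subsetI)
      fix h assume "h \<in> list_coset ?n ts qs"
      then obtain a where a: "a \<in> P" "a \<in> auto ?G" "h = compose X t a"
        unfolding list_coset_def qs(2) ts X_def[symmetric] by blast
      have ga: "compose X g a \<in> P" using subgroup.m_closed[OF P g(1) a(1)] mult g a by simp
      have "h = compose X (list_fun s) (compose X g a)"
        using a g maps by (auto simp: compose_def restrict_def)
      then have "h \<in> list_coset ?n s ps"
        using ga unfolding list_coset_def P_def X_def by blast
      moreover have "a \<in> iso ?G ?G"
        using a(2) by (auto simp: auto_def iso_def Bij_def)
      from iso_set_trans[OF this t] have "compose (carrier ?G) t a \<in> iso ?G ?H"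
        by (rule G.iso_eq) (simp add: compose_eq)
      then have "h \<in> iso ?G ?H" using a(3) cG by simp
      ultimately show "h \<in> I" by (simp add: I_def)
    next
      fix h assume "h \<in> I"
      then obtain b where b: "b \<in> P" "h = compose X (list_fun s) b" and h: "h \<in> iso ?G ?H"
        by (auto simp: I_def list_coset_def P_def X_def)
      define a where "a = inv\<^bsub>BijGroup X\<^esub> g \<otimes>\<^bsub>BijGroup X\<^esub> b"
      have ig: "inv\<^bsub>BijGroup X\<^esub> g \<in> P" using subgroup.m_inv_closed[OF P g(1)] .
      have aP: "a \<in> P" unfolding a_def using subgroup.m_closed[OF P ig b(1)] .
      have gb: "g \<in> carrier (BijGroup X)" "b \<in> carrier (BijGroup X)"
        using g(1) b(1) subgroup.subset[OF P] by auto
      have "g \<otimes>\<^bsub>BijGroup X\<^esub> a = b" unfolding a_def using gb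
        by (simp add: Sym.m_assoc[symmetric])
      then have ga: "compose X g a = b" using mult g(1) aP by simp
      have h_eq: "h = compose X t a"
        unfolding b(2) g(2) ga[symmetric] using maps[OF aP]
        by (auto simp: compose_def restrict_def)
      have "a \<in> hom ?G ?G"
      proof (rule homI)
        fix y assume "y \<in> carrier ?G" then show "a y \<in> carrier ?G" using maps aP cG by simp
      next
        fix y z assume yz: "y \<in> carrier ?G" "z \<in> carrier ?G"
        have ht: "h w = t (a w)" if "w \<in> carrier ?G" for w
          using that h_eq cG by (simp add: compose_eq)
        have ac: "a y \<in> carrier ?G" "a z \<in> carrier ?G" "a (y \<otimes>\<^bsub>?G\<^esub> z) \<in> carrier ?G"
          using yz maps[OF aP] cG G.m_closed by auto
        have "t (a (y \<otimes>\<^bsub>?G\<^esub> z)) = h y \<otimes>\<^bsub>?H\<^esub> h z"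
          using h yz ht by (auto simp: iso_def hom_def)
        also have "\<dots> = t (a y \<otimes>\<^bsub>?G\<^esub> a z)"
          using t ac yz ht by (auto simp: iso_def hom_def)
        finally show "a (y \<otimes>\<^bsub>?G\<^esub> z) = a y \<otimes>\<^bsub>?G\<^esub> a z"
          using tinj ac cG G.m_closed by (auto dest: inj_onD)
      qed
      then have "a \<in> P \<inter> auto ?G" using aP PB cG by (auto simp: auto_def)
      then show "h \<in> list_coset ?n ts qs"
        unfolding list_coset_def qs(2) ts X_def[symmetric] using h_eq by blast
    qed
    moreover have "length ts = ?n" by (simp add: ts_def)
    ultimately have "Some (ts, qs) \<in> GRIS_solutions x"
      using False qs(1) by (auto simp: GRIS_solutions_def x I_def[symmetric])
    then show ?thesis by blast
  qed
qed

end

theory Submission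
  imports Defs "HOL-Combinatorics.Permutations"
begin

text \<open>
  A bilinear map \<open>f : B \<times> B \<rightarrow> A\<close> is a 2-cocycle, so
  \<open>(a, x) (b, y) = (a + b + f x y, x + y)\<close> defines a group \<open>G\<close> on \<open>A \<times> B\<close>. For a permutation \<open>\<gamma>\<close> of \<open>B\<close>,
  the permutation \<open>(a, x) \<mapsto> (a, \<gamma> x)\<close> is an automorphism of \<open>G\<close> iff \<open>\<gamma>\<close> is an isometry of \<open>f\<close>.
  Hence an instance of BI is mapped to \<open>(G, G)\<close> with the permutation group \<open>Sym(B)\<close> acting on
  the second component, generated by the transpositions \<open>(0 i)\<close>. The isomorphisms in this group
  form a subgroup; if they are given as the coset of \<open>t\<close> under the group generated by \<open>qs\<close>,
  then \<open>t\<close> and \<open>qs\<close> generate it, and their actions on \<open>B\<close> generate the isometry group.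

  Both maps of the reduction are computed by structured programs that scan the input and keep
  finitely many counters, each bounded by the length of the input. A counter is the head position
  on a tape of its own, so such programs compile directly to multitape machines.
\<close>


section \<open>Counter programs on Turing machines\<close>

text \<open>The product of (a, x) and (b, y) carries f x y in its first coordinate and x + y in its
  second. A map that keeps first coordinates and applies \<gamma> to the second is therefore
  multiplicative exactly when \<gamma> is additive (second coordinate) and preserves f (first
  coordinate).

  A pair is the number a * n + x with n = \<open>length B\<close>. A lifted permutation acts alike
  on every block of n numbers, so its values on the first block give \<gamma> back, and recovering a
  solution amounts to truncating lists. The number 0 is merely some element of A; its unit may have
  another number.

  The shape of the programs comes from the machine model: there is no arithmetic on registers and no
  comparison of two of them. Products are therefore written out by nested loops, and the case
  distinction in a transposition becomes a sequence of ranges. The transpositions (0 i) suit this: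
  the lengths of their ranges are the index and the counter of a single loop.

  The answer \<open>None\<close> cannot occur for the constructed instances, because the identity is
  an isomorphism in the coset.\<close>

datatype test = Reads "nat set" | NonZero nat

datatype cmd =
    Inc nat | Dec nat | Fwd | Bwd | Emit bool
  | Seq cmd cmd (infixr ";;" 60)
  | While test cmd

type_synonym regs = "nat \<Rightarrow> nat"
type_synonym state = "int \<times> regs \<times> word"

fun holds :: "word \<Rightarrow> test \<Rightarrow> state \<Rightarrow> bool" where
  "holds w (Reads S) (p, \<rho>, u) \<longleftrightarrow> word_contents w p \<in> S"
| "holds w (NonZero r) (p, \<rho>, u) \<longleftrightarrow> \<rho> r \<noteq> 0"

text \<open>There is no rule for \<open>Dec\<close> at 0: on the tape the head would pass to the
  left of the mark, to a position that represents no register value. Times are exact numbers of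
  machine steps: one for each test or elementary command, none for sequencing.\<close>

inductive exec :: "word \<Rightarrow> cmd \<Rightarrow> state \<Rightarrow> nat \<Rightarrow> state \<Rightarrow> bool" for w where
  Inc: "exec w (Inc r) (p, \<rho>, u) 1 (p, \<rho>(r := \<rho> r + 1), u)"
| Dec: "\<rho> r \<noteq> 0 \<Longrightarrow> exec w (Dec r) (p, \<rho>, u) 1 (p, \<rho>(r := \<rho> r - 1), u)"
| Fwd: "exec w Fwd (p, \<rho>, u) 1 (p + 1, \<rho>, u)"
| Bwd: "exec w Bwd (p, \<rho>, u) 1 (p - 1, \<rho>, u)"
| Emit: "exec w (Emit b) (p, \<rho>, u) 1 (p, \<rho>, u @ [b])"
| Seq: "exec w c s t s' \<Longrightarrow> exec w d s' t' s'' \<Longrightarrow> exec w (c ;; d) s (t + t') s''"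
| WhileF: "\<not> holds w b s \<Longrightarrow> exec w (While b c) s 1 s"
| WhileT: "holds w b s \<Longrightarrow> exec w c s t s' \<Longrightarrow> exec w (While b c) s' t' s'' \<Longrightarrow>
    exec w (While b c) s (1 + t + t') s''"

text \<open>
  A register is a tape that carries a mark at position 0 only; its value is the position of the
  head. Hence incrementing, decrementing and testing for 0 take a single step each.
\<close>

definition mark :: "int \<Rightarrow> nat" where
  "mark i = (if i = 0 then 1 else 0)"

text \<open>Tapes 0 and 1 are fixed as input and output by \<open>tm_init\<close> and
  \<open>tm_computes_within\<close>, so register r lives on tape r + 2. The output head stands on
  the blank behind the word written so far.\<close>

definition state_tapes :: "nat \<Rightarrow> word \<Rightarrow> state \<Rightarrow> tape list" where
  "state_tapes K w = (\<lambda>(p, \<rho>, u).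
     (word_contents w, p) # (word_contents u, int (length u)) #
     map (\<lambda>r. (mark, int (\<rho> r))) [0..<K])"

fun test_syms :: "test \<Rightarrow> nat list \<Rightarrow> bool" where
  "test_syms (Reads S) rs \<longleftrightarrow> rs ! 0 \<in> S"
| "test_syms (NonZero r) rs \<longleftrightarrow> rs ! (r + 2) \<noteq> 1"

definition keep :: "nat list \<Rightarrow> (nat \<times> move) list" where
  "keep rs = map (\<lambda>a. (a, Stay)) rs"

fun code_size :: "cmd \<Rightarrow> nat" where
  "code_size (c ;; d) = code_size c + code_size d"
| "code_size (While b c) = code_size c + 1"
| "code_size _ = 1"

text \<open>Execution starts in state 0 and ends in state \<open>code_size c\<close>.\<close>

fun code :: "cmd \<Rightarrow> nat \<Rightarrow> nat list \<Rightarrow> nat \<times> (nat \<times> move) list" where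
  "code (Inc r) q rs = (1, (keep rs)[r + 2 := (rs ! (r + 2), MoveRight)])"
| "code (Dec r) q rs = (1, (keep rs)[r + 2 := (rs ! (r + 2), MoveLeft)])"
| "code Fwd q rs = (1, (keep rs)[0 := (rs ! 0, MoveRight)])"
| "code Bwd q rs = (1, (keep rs)[0 := (rs ! 0, MoveLeft)])"
| "code (Emit b) q rs = (1, (keep rs)[1 := (if b then 2 else 1, MoveRight)])"
| "code (c ;; d) q rs =
     (if q < code_size c then code c q rs
      else apfst ((+) (code_size c)) (code d (q - code_size c) rs))"
| "code (While b c) q rs =
     (if q = 0 then (if test_syms b rs then 1 else code_size c + 1, keep rs)
      else apfst (\<lambda>q'. if q' = code_size c then 0 else q' + 1) (code c (q - 1) rs))"

fun uses_below :: "nat \<Rightarrow> cmd \<Rightarrow> bool" where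
  "uses_below K (Inc r) \<longleftrightarrow> r < K"
| "uses_below K (Dec r) \<longleftrightarrow> r < K"
| "uses_below K (c ;; d) \<longleftrightarrow> uses_below K c \<and> uses_below K d"
| "uses_below K (While b c) \<longleftrightarrow> (case b of NonZero r \<Rightarrow> r < K | Reads _ \<Rightarrow> True) \<and> uses_below K c"
| "uses_below K _ \<longleftrightarrow> True"

lemma uses_below_mono: "uses_below K c \<Longrightarrow> K \<le> K' \<Longrightarrow> uses_below K' c"
  by (induction c) (auto split: test.splits)

lemma ex_uses_below: "\<exists>K. uses_below K c"
proof (induction c)
  case (Seq c d)
  then obtain K K' where "uses_below K c" "uses_below K' d" by auto
  then have "uses_below (max K K') (c ;; d)"
    by (auto intro: uses_below_mono)
  then show ?case ..
next
  case (While b c)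
  then obtain K where K: "uses_below K c" by auto
  obtain K' where "case b of NonZero r \<Rightarrow> r < K' | Reads _ \<Rightarrow> True"
    by (cases b) auto
  with K have "uses_below (max K K') (While b c)"
    by (auto intro: uses_below_mono split: test.splits)
  then show ?case ..
qed auto

lemma code_size_pos: "code_size c > 0"
  by (induction c) auto

section \<open>Runs of compiled code\<close>

definition code_step :: "cmd \<Rightarrow> config \<Rightarrow> config" where
  "code_step c cf = (case code c (fst cf) (map read_tape (snd cf)) of
     (q, as) \<Rightarrow> (q, map2 act_tape as (snd cf)))"

text \<open>A step is allowed only before the final state of \<open>c\<close>. Hence a walk stays
  valid when \<open>c\<close> is embedded into larger code, which continues differently from that
  state.\<close>

inductive walk :: "cmd \<Rightarrow> config \<Rightarrow> nat \<Rightarrow> config \<Rightarrow> bool" for c where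
  walk_refl: "walk c cf 0 cf"
| walk_step: "fst cf < code_size c \<Longrightarrow> walk c (code_step c cf) t cf' \<Longrightarrow> walk c cf (Suc t) cf'"

lemma walk_trans: "walk c cf t cf' \<Longrightarrow> walk c cf' t' cf'' \<Longrightarrow> walk c cf (t + t') cf''"
  by (induction rule: walk.induct) (auto intro: walk.intros)

lemma walk_Seq1: "walk c cf t cf' \<Longrightarrow> walk (c ;; d) cf t cf'"
proof (induction rule: walk.induct)
  case (walk_step cf t cf')
  then have "code_step (c ;; d) cf = code_step c cf" by (simp add: code_step_def)
  with walk_step show ?case by (auto intro: walk.intros)
qed (rule walk_refl)

lemma walk_Seq2:
  "walk d cf t cf' \<Longrightarrow>
     walk (c ;; d) (apfst ((+) (code_size c)) cf) t (apfst ((+) (code_size c)) cf')"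
proof (induction rule: walk.induct)
  case (walk_step cf t cf')
  then have "code_step (c ;; d) (apfst ((+) (code_size c)) cf)
      = apfst ((+) (code_size c)) (code_step d cf)"
    by (simp add: code_step_def split: prod.splits)
  with walk_step show ?case by (auto intro: walk.intros)
qed (rule walk_refl)

text \<open>State 0 holds the test, so the states of the body move up by one and its final state
  becomes 0. A walk meets the final state only at its end; until then the renaming is just
  \<open>Suc\<close>.\<close>

lemma walk_While:
  "walk c cf t cf' \<Longrightarrow> fst cf < code_size c \<Longrightarrow>
     walk (While b c) (apfst Suc cf) t
       (apfst (\<lambda>q'. if q' = code_size c then 0 else q' + 1) cf')"
proof (induction rule: walk.induct)
  case (walk_refl cf)
  then show ?case by (cases cf) (auto intro: walk.intros)
next
  case (walk_step cf t cf')
  let ?h = "\<lambda>q'. if q' = code_size c then 0 else q' + 1"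
  have *: "code_step (While b c) (apfst Suc cf) = apfst ?h (code_step c cf)"
    by (simp add: code_step_def split: prod.splits)
  show ?case
  proof (cases "fst (code_step c cf) < code_size c")
    case True
    then have "apfst ?h (code_step c cf) = apfst Suc (code_step c cf)"
      by (cases "code_step c cf") auto
    with walk_step True * show ?thesis by (auto intro!: walk.walk_step)
  next
    case False
    \<comment> \<open>No step leaves the final state, so the rest of the walk is empty.\<close>
    with walk_step.hyps(2) have "t = 0 \<and> cf' = code_step c cf"
      by (auto elim: walk.cases)
    with walk_step * show ?thesis by (auto intro!: walk.walk_step walk.walk_refl)
  qed
qed

lemma act_keep_update:
  assumes "k < length tps"
  shows "map2 act_tape ((keep (map read_tape tps))[k := x]) tps = tps[k := act_tape x (tps ! k)]"
  using assms
  by (intro nth_equalityI) (auto simp: keep_def nth_list_update act_tape_def read_tape_def)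

lemma code_step_update:
  assumes "k < length tps"
    and "code c 0 (map read_tape tps) = (q, (keep (map read_tape tps))[k := x])"
  shows "code_step c (0, tps) = (q, tps[k := act_tape x (tps ! k)])"
  using assms by (simp add: code_step_def act_keep_update)

lemma act_keep: "map2 act_tape (keep (map read_tape tps)) tps = tps"
  by (intro nth_equalityI) (auto simp: keep_def act_tape_def read_tape_def)

lemma length_state_tapes [simp]: "length (state_tapes K w s) = K + 2"
  by (simp add: state_tapes_def split: prod.splits)

lemma test_syms_state_tapes:
  assumes "case b of NonZero r \<Rightarrow> r < K | Reads _ \<Rightarrow> True"
  shows "test_syms b (map read_tape (state_tapes K w s)) \<longleftrightarrow> holds w b s"
  using assms by (cases b; cases s) (auto simp: state_tapes_def read_tape_def mark_def)

lemma state_tapes_reg_update: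
  "r < K \<Longrightarrow> i = int v \<Longrightarrow> (state_tapes K w (p, \<rho>, u))[Suc (Suc r) := (mark, i)] = state_tapes K w (p, \<rho>(r := v), u)"
  by (simp add: state_tapes_def) (intro nth_equalityI; auto simp: nth_list_update)

lemma state_tapes_reg_nth:
  "r < K \<Longrightarrow> state_tapes K w (p, \<rho>, u) ! Suc (Suc r) = (mark, int (\<rho> r))"
  by (simp add: state_tapes_def)

lemma word_contents_snoc:
  "(word_contents u)(int (length u) := if b then 2 else 1) = word_contents (u @ [b])"
  by (auto simp: word_contents_def nth_append fun_eq_iff)

text \<open>The induction follows the execution, not the program, because the remaining rounds of a
  loop are an execution of the same loop.\<close>

lemma exec_walk:
  assumes "exec w c s t s'" "uses_below K c"
  shows "walk c (0, state_tapes K w s) t (code_size c, state_tapes K w s')"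
proof -
  have one: "walk c (0, tps) 1 (code_size c, tps')"
    if "code_step c (0, tps) = (code_size c, tps')" for c tps tps'
    using walk_step[of "(0, tps)" c 0] walk_refl that code_size_pos[of c] by auto
  from assms show ?thesis
  proof (induction rule: exec.induct)
    case (Seq c s t s' d t' s'')
    then have "walk (c ;; d) (0, state_tapes K w s) t (code_size c, state_tapes K w s')"
      by (auto intro: walk_Seq1)
    moreover have "walk (c ;; d) (code_size c, state_tapes K w s') t'
        (code_size (c ;; d), state_tapes K w s'')"
      using walk_Seq2[of d "(0, state_tapes K w s')" t' "(code_size d, state_tapes K w s'')" c] Seq
      by auto
    ultimately show ?case by (rule walk_trans)
  next
    case (WhileF b s c)
    then show ?case
      by (intro one) (simp add: code_step_def test_syms_state_tapes act_keep)
  next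
    case (WhileT b s c t s' t' s'')
    have "walk (While b c) (0, state_tapes K w s) (Suc 0) (1, state_tapes K w s)"
      using WhileT
      by (intro walk_step) (auto simp: code_step_def test_syms_state_tapes act_keep intro: walk.intros)
    moreover have "walk (While b c) (1, state_tapes K w s) t (0, state_tapes K w s')"
      using walk_While[of c "(0, state_tapes K w s)" t "(code_size c, state_tapes K w s')" b]
        WhileT code_size_pos[of c] by auto
    moreover have "walk (While b c) (0, state_tapes K w s') t'
        (code_size (While b c), state_tapes K w s'')"
      using WhileT by blast
    ultimately show ?case by (metis walk_trans plus_1_eq_Suc One_nat_def)
  next
    case (Inc r p \<rho> u)
    then show ?case
      by (intro one, subst code_step_update[where k = "r + 2"])
        (auto simp: state_tapes_reg_nth act_tape_def read_tape_def intro!: state_tapes_reg_update)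
  next
    case (Dec \<rho> r p u)
    then show ?case
      by (intro one, subst code_step_update[where k = "r + 2"])
        (auto simp: state_tapes_reg_nth act_tape_def read_tape_def intro!: state_tapes_reg_update)
  next
    case (Fwd p \<rho> u)
    then show ?case
      by (intro one, subst code_step_update[where k = 0])
        (auto simp: state_tapes_def act_tape_def read_tape_def)
  next
    case (Bwd p \<rho> u)
    then show ?case
      by (intro one, subst code_step_update[where k = 0])
        (auto simp: state_tapes_def act_tape_def read_tape_def)
  next
    case (Emit b p \<rho> u)
    then show ?case
      by (intro one, subst code_step_update[where k = 1])
        (auto simp: state_tapes_def act_tape_def read_tape_def simp flip: word_contents_snoc)
  qed
qed

section \<open>The Turing machine of a program\<close>

text \<open>All tapes except the input start blank. An additional first state writes the mark at
  position 0 of each register tape; the code follows, shifted by one state.\<close>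

definition machine :: "nat \<Rightarrow> cmd \<Rightarrow> tm" where
  "machine K c =
     \<lparr>tapes = K + 2, syms = 3, states = code_size c + 1,
      delta = (\<lambda>q rs.
        if q = 0 then (1, map (\<lambda>k. (if k < 2 then rs ! k else 1, Stay)) [0..<length rs])
        else apfst Suc (code c (q - 1) rs))\<rparr>"

lemma code_wf:
  assumes "q < code_size c" "length rs = K + 2" "set rs \<subseteq> {..<3}" "uses_below K c"
  shows "fst (code c q rs) \<le> code_size c \<and> length (snd (code c q rs)) = K + 2 \<and>
    fst ` set (snd (code c q rs)) \<subseteq> {..<3}"
proof -
  have keep: "fst ` set (keep rs) \<subseteq> {..<3}" using assms(3) by (auto simp: keep_def)
  have upd: "fst ` set ((keep rs)[k := x]) \<subseteq> {..<3}" if "fst x < 3" for k x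
    using set_update_subset_insert[of "keep rs" k x] keep that by fastforce
  have nth: "rs ! k < 3" if "k < K + 2" for k
    using subsetD[OF assms(3) nth_mem, of k] assms(2) that by simp
  have len: "length (keep rs) = K + 2" using assms(2) by (simp add: keep_def)
  from assms(1,4) show ?thesis
  proof (induction c arbitrary: q)
    case (Seq c d)
    show ?case
    proof (cases "q < code_size c")
      case True
      with Seq.IH(1)[of q] Seq.prems show ?thesis by auto
    next
      case False
      with Seq.prems have "q - code_size c < code_size d" by auto
      with Seq.IH(2)[of "q - code_size c"] Seq.prems False show ?thesis by auto
    qed
  next
    case (While b c)
    show ?case
    proof (cases "q = 0")
      case True
      with keep len show ?thesis by auto
    next
      case False
      with While.prems have "q - 1 < code_size c" by auto
      with While.IH[of "q - 1"] While.prems False show ?thesis by auto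
    qed
  qed (simp_all add: upd nth len)
qed

lemma wf_machine:
  assumes "uses_below K c"
  shows "wf_tm (machine K c)"
proof -
  have "fst (delta (machine K c) q rs) \<le> code_size c + 1 \<and>
      length (snd (delta (machine K c) q rs)) = K + 2 \<and>
      fst ` set (snd (delta (machine K c) q rs)) \<subseteq> {..<3}"
    if q: "q < code_size c + 1" and rs: "length rs = K + 2" "set rs \<subseteq> {..<3}" for q rs
  proof (cases "q = 0")
    case True
    have "rs ! k < 3" if "k < K + 2" for k
      using subsetD[OF rs(2) nth_mem, of k] rs(1) that by simp
    with True rs(1) show ?thesis by (auto simp: machine_def)
  next
    case False
    with code_wf[of "q - 1" c rs K] assms q rs show ?thesis by (simp add: machine_def)
  qed
  then show ?thesis by (simp add: wf_tm_def machine_def)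
qed

lemma walk_machine:
  "walk c cf t cf' \<Longrightarrow> (tm_step (machine K c) ^^ t) (apfst Suc cf) = apfst Suc cf'"
proof (induction rule: walk.induct)
  case (walk_step cf t cf')
  then have "tm_step (machine K c) (apfst Suc cf) = apfst Suc (code_step c cf)"
    by (auto simp: tm_step_def machine_def code_step_def split: prod.splits)
  with walk_step show ?case by (simp add: funpow_swap1)
qed simp

lemma machine_init:
  "tm_step (machine K c) (tm_init (machine K c) w) = (1, state_tapes K w (0, \<lambda>_. 0, []))"
proof -
  let ?ts = "(word_contents w, 0) # replicate (Suc K) (word_contents [], 0) :: tape list"
  let ?as = "map (\<lambda>k. (if k < 2 then map read_tape ?ts ! k else 1, Stay)) [0..<K + 2]"
  have mark: "(word_contents [])(0 := Suc 0) = mark"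
    by (auto simp: word_contents_def mark_def)
  have "map2 act_tape ?as ?ts = state_tapes K w (0, \<lambda>_. 0, [])"
  proof (rule nth_equalityI)
    fix i assume i: "i < length (map2 act_tape ?as ?ts)"
    then have *: "map2 act_tape ?as ?ts ! i = act_tape (?as ! i) (?ts ! i)"
      by (intro nth_map[THEN trans]) (simp_all del: upt_Suc replicate_Suc map_append)
    consider "i = 0" | "i = 1" | j where "i = Suc (Suc j)" "j < K"
      using i by (cases i; cases "i - 1") (auto simp del: upt_Suc)
    then show "map2 act_tape ?as ?ts ! i = state_tapes K w (0, \<lambda>_. 0, []) ! i"
      unfolding * by cases (auto simp: act_tape_def read_tape_def state_tapes_def mark simp del: upt_Suc)
  qed (simp del: upt_Suc)
  then show ?thesis
    by (simp add: tm_step_def tm_init_def machine_def del: upt_Suc replicate_Suc replicate.simps list.map)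
qed

text \<open>The bound is strict because writing the marks costs one step in addition to the t steps
  of the program.\<close>

lemma machine_computes:
  assumes "exec w c (0, \<lambda>_. 0, []) t (p, \<rho>, v)" "uses_below K c" "t < T"
  shows "tm_computes_within (machine K c) w v T"
proof -
  have "(tm_step (machine K c) ^^ Suc t) (tm_init (machine K c) w)
      = apfst Suc (code_size c, state_tapes K w (p, \<rho>, v))"
    using walk_machine[OF exec_walk[OF assms(1,2)], of K]
    by (simp only: funpow_Suc_right o_apply machine_init) simp
  with assms(3) show ?thesis
    unfolding tm_computes_within_def
    by (intro exI[of _ "Suc t"]) (auto simp: machine_def state_tapes_def)
qed

section \<open>Execution within a time bound\<close>

definition runs :: "word \<Rightarrow> cmd \<Rightarrow> nat \<Rightarrow> state \<Rightarrow> state \<Rightarrow> bool" where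
  "runs w c T s s' \<longleftrightarrow> (\<exists>t\<le>T. exec w c s t s')"

lemma runs_mono: "runs w c T s s' \<Longrightarrow> T \<le> T' \<Longrightarrow> runs w c T' s s'"
  unfolding runs_def using le_trans by blast

lemma runs_Seq: "runs w c T s s' \<Longrightarrow> runs w d T' s' s'' \<Longrightarrow> runs w (c ;; d) (T + T') s s''"
  unfolding runs_def by (meson exec.Seq add_mono)

lemma runs_Inc: "\<rho>' = \<rho>(r := \<rho> r + 1) \<Longrightarrow> runs w (Inc r) 1 (p, \<rho>, u) (p, \<rho>', u)"
  unfolding runs_def using exec.Inc by blast

lemma runs_Dec:
  "\<rho> r \<noteq> 0 \<Longrightarrow> \<rho>' = \<rho>(r := \<rho> r - 1) \<Longrightarrow> runs w (Dec r) 1 (p, \<rho>, u) (p, \<rho>', u)"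
  unfolding runs_def using exec.Dec by blast

lemma runs_Fwd: "runs w Fwd 1 (p, \<rho>, u) (p + 1, \<rho>, u)"
  unfolding runs_def using exec.Fwd by blast

lemma runs_Bwd: "runs w Bwd 1 (p, \<rho>, u) (p - 1, \<rho>, u)"
  unfolding runs_def using exec.Bwd by blast

lemma runs_Emit: "runs w (Emit b) 1 (p, \<rho>, u) (p, \<rho>, u @ [b])"
  unfolding runs_def using exec.Emit by blast

lemma runs_WhileF: "\<not> holds w b s \<Longrightarrow> runs w (While b c) 1 s s"
  unfolding runs_def using exec.WhileF by blast

lemma runs_WhileT:
  assumes "holds w b s" "runs w c T s s'" "runs w (While b c) T' s' s''"
  shows "runs w (While b c) (1 + T + T') s s''"
proof -
  obtain t t' where "t \<le> T" "t' \<le> T'" "exec w c s t s'" "exec w (While b c) s' t' s''"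
    using assms(2,3) unfolding runs_def by blast
  moreover from this have "exec w (While b c) s (1 + t + t') s''"
    using assms(1) by (blast intro: exec.WhileT)
  moreover have "1 + t + t' \<le> 1 + T + T'" using calculation by simp
  ultimately show ?thesis unfolding runs_def by blast
qed

text \<open>The sequence S of states between the rounds plays the role of a loop invariant. The time
  counts n bodies and n + 1 tests.\<close>

lemma runs_While:
  assumes "\<And>i. i < n \<Longrightarrow> holds w b (S i)" "\<And>i. i < n \<Longrightarrow> runs w c T (S i) (S (Suc i))"
    and "\<not> holds w b (S n)"
  shows "runs w (While b c) (n * (T + 1) + 1) (S 0) (S n)"
  using assms
proof (induction n arbitrary: S)
  case 0
  then show ?case using runs_WhileF[of w b "S 0" c] by simp
next
  case (Suc n)
  have "runs w (While b c) (n * (T + 1) + 1) (S (Suc 0)) (S (Suc n))"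
    using Suc.IH[of "\<lambda>i. S (Suc i)"] Suc.prems by simp
  moreover have "holds w b (S 0)" "runs w c T (S 0) (S (Suc 0))" using Suc.prems by auto
  ultimately have "runs w (While b c) (1 + T + (n * (T + 1) + 1)) (S 0) (S (Suc n))"
    by (blast intro: runs_WhileT)
  then show ?case by (rule runs_mono) simp
qed

section \<open>Loops over the value of a register\<close>

definition Zero :: "nat \<Rightarrow> cmd" where
  "Zero r = While (NonZero r) (Dec r)"

text \<open>Register 0 is the scratch register of \<open>Copy\<close>.\<close>

definition Copy :: "nat \<Rightarrow> nat \<Rightarrow> cmd" where
  "Copy b k = While (NonZero b) (Dec b ;; Inc k ;; Inc 0) ;; While (NonZero 0) (Dec 0 ;; Inc b)"

text \<open>A loop consumes its counter, so a copy is consumed and the bound stays available to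
  other loops. Since the decrement precedes the body, the counter shows n - 1 - i during round i;
  \<open>swap_cmd\<close> makes use of this value.\<close>

definition Rep :: "nat \<Rightarrow> nat \<Rightarrow> cmd \<Rightarrow> cmd" where
  "Rep b k c = Copy b k ;; While (NonZero k) (Dec k ;; c)"

definition For :: "nat \<Rightarrow> nat \<Rightarrow> nat \<Rightarrow> cmd \<Rightarrow> cmd" where
  "For r b k c = Rep b k (c ;; Inc r) ;; Zero r"

lemma runs_Zero: "runs w (Zero r) (\<rho> r * (1 + 1) + 1) (p, \<rho>, u) (p, \<rho>(r := 0), u)"
proof -
  let ?S = "\<lambda>i. (p, \<rho>(r := \<rho> r - i), u)"
  have "runs w (While (NonZero r) (Dec r)) (\<rho> r * (1 + 1) + 1) (?S 0) (?S (\<rho> r))"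
  proof (rule runs_While)
    fix i assume "i < \<rho> r"
    then show "runs w (Dec r) 1 (?S i) (?S (Suc i))"
      by (intro runs_Dec) auto
  qed auto
  then show ?thesis by (simp add: Zero_def)
qed

lemma runs_Copy:
  assumes "b \<noteq> k" "b \<noteq> 0" "k \<noteq> 0" "\<rho> k = 0" "\<rho> 0 = 0"
  shows "runs w (Copy b k) (7 * \<rho> b + 2) (p, \<rho>, u) (p, \<rho>(k := \<rho> b), u)"
proof -
  let ?n = "\<rho> b"
  let ?S = "\<lambda>i. (p, \<rho>(b := ?n - i, k := i, 0 := i), u)"
  let ?R = "\<lambda>i. (p, \<rho>(b := i, k := ?n, 0 := ?n - i), u)"
  have 1: "runs w (While (NonZero b) (Dec b ;; Inc k ;; Inc 0)) (?n * (1 + (1 + 1) + 1) + 1) (?S 0) (?S ?n)"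
  proof (rule runs_While)
    fix i assume i: "i < ?n"
    have a: "runs w (Dec b) 1 (?S i) (p, \<rho>(b := ?n - Suc i, k := i, 0 := i), u)"
      by (intro runs_Dec) (use i assms in \<open>auto simp: fun_eq_iff\<close>)
    have b: "runs w (Inc k) 1 (p, \<rho>(b := ?n - Suc i, k := i, 0 := i), u)
        (p, \<rho>(b := ?n - Suc i, k := Suc i, 0 := i), u)"
      by (intro runs_Inc) (use i assms in \<open>auto simp: fun_eq_iff\<close>)
    have c: "runs w (Inc 0) 1 (p, \<rho>(b := ?n - Suc i, k := Suc i, 0 := i), u) (?S (Suc i))"
      by (intro runs_Inc) (use i assms in \<open>auto simp: fun_eq_iff\<close>)
    show "runs w (Dec b ;; Inc k ;; Inc 0) (1 + (1 + 1)) (?S i) (?S (Suc i))"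
      by (rule runs_Seq[OF a runs_Seq[OF b c]])
  qed (use assms in auto)
  have 2: "?S 0 = (p, \<rho>, u)" using assms by (auto simp: fun_eq_iff)
  have 3: "?S ?n = ?R 0" by simp
  have 4: "runs w (While (NonZero 0) (Dec 0 ;; Inc b)) (?n * (1 + 1 + 1) + 1) (?R 0) (?R ?n)"
  proof (rule runs_While)
    fix i assume i: "i < ?n"
    have a: "runs w (Dec 0) 1 (?R i) (p, \<rho>(b := i, k := ?n, 0 := ?n - Suc i), u)"
      by (intro runs_Dec) (use i assms in \<open>auto simp: fun_eq_iff\<close>)
    have c: "runs w (Inc b) 1 (p, \<rho>(b := i, k := ?n, 0 := ?n - Suc i), u) (?R (Suc i))"
      by (intro runs_Inc) (use i assms in \<open>auto simp: fun_eq_iff\<close>)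
    show "runs w (Dec 0 ;; Inc b) (1 + 1) (?R i) (?R (Suc i))"
      by (rule runs_Seq[OF a c])
  qed (use assms in auto)
  have 5: "?R ?n = (p, \<rho>(k := ?n), u)" using assms by (auto simp: fun_eq_iff)
  have "runs w (Copy b k) (?n * (1 + (1 + 1) + 1) + 1 + (?n * (1 + 1 + 1) + 1)) (?S 0) (?R ?n)"
    using 1 4 unfolding Copy_def 3 by (rule runs_Seq)
  then show ?thesis unfolding 2 5 by (rule runs_mono) simp
qed

lemma runs_Rep:
  assumes regs: "b \<noteq> k" "b \<noteq> 0" "k \<noteq> 0" "\<rho> k = 0" "\<rho> 0 = 0" "\<rho> b = n"
    and body: "\<And>i. i < n \<Longrightarrow> runs w c T (p i, (R i)(k := n - 1 - i), u i)
      (p (Suc i), (R (Suc i))(k := n - 1 - i), u (Suc i))"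
    and R: "R 0 = \<rho>" "R n k = 0"
  shows "runs w (Rep b k c) (n * (T + 9) + 3) (p 0, \<rho>, u 0) (p n, R n, u n)"
proof -
  \<comment> \<open>\<open>R i\<close> describes the registers after i rounds apart from the
    counter, which is overridden by the number of rounds left.\<close>
  let ?S = "\<lambda>i. (p i, (R i)(k := n - i), u i)"
  have 1: "runs w (While (NonZero k) (Dec k ;; c)) (n * (1 + T + 1) + 1) (?S 0) (?S n)"
  proof (rule runs_While)
    fix i assume i: "i < n"
    have "runs w (Dec k) 1 (?S i) (p i, (R i)(k := n - 1 - i), u i)"
      by (intro runs_Dec) (use i in auto)
    moreover have "runs w c T (p i, (R i)(k := n - 1 - i), u i) (?S (Suc i))"
      using body[OF i] by simp
    ultimately show "runs w (Dec k ;; c) (1 + T) (?S i) (?S (Suc i))"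
      by (rule runs_Seq)
  qed auto
  have 2: "runs w (Copy b k) (7 * n + 2) (p 0, \<rho>, u 0) (?S 0)"
    using runs_Copy[of b k \<rho> w "p 0" "u 0"] regs R by simp
  have 3: "?S n = (p n, R n, u n)" using R by (auto simp: fun_eq_iff)
  have "runs w (Rep b k c) (7 * n + 2 + (n * (1 + T + 1) + 1)) (p 0, \<rho>, u 0) (?S n)"
    using 2 1 unfolding Rep_def by (rule runs_Seq)
  then show ?thesis unfolding 3 by (rule runs_mono) (simp add: algebra_simps)
qed


section \<open>Access to tables\<close>

abbreviation enc_table :: "table \<Rightarrow> word" where
  "enc_table \<equiv> enc_list (enc_list enc_nat)"

text \<open>Without terminator or count, this agrees with the concatenation in
  \<open>enc_pair\<close>; each program knows how many tables to expect.\<close>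

definition enc_tables :: "table list \<Rightarrow> word" where
  "enc_tables Ts = concat (map enc_table Ts)"

text \<open>The left end is recognised by the blank at position -1. The first step to the left
  covers the case that the head stands on the blank behind the input.\<close>

definition Rewind :: cmd where
  "Rewind = Bwd ;; While (Reads {1, 2}) Bwd ;; Fwd"

lemma runs_Rewind:
  assumes "0 \<le> p" "p \<le> int (length w)"
  shows "runs w Rewind (2 * length w + 3) (p, \<rho>, u) (0, \<rho>, u)"
proof -
  let ?S = "\<lambda>i. (p - 1 - int i, \<rho>, u)"
  have "runs w (While (Reads {1, 2}) Bwd) (nat p * (1 + 1) + 1) (?S 0) (?S (nat p))"
  proof (rule runs_While)
    fix i assume "i < nat p"
    then show "holds w (Reads {1, 2}) (?S i)"
      using assms by (auto simp: word_contents_def)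
    show "runs w Bwd 1 (?S i) (?S (Suc i))"
      using runs_Bwd[of w "p - 1 - int i" \<rho> u] by (simp add: algebra_simps)
  qed (use assms in \<open>auto simp: word_contents_def\<close>)
  then have 1: "runs w (While (Reads {1, 2}) Bwd) (nat p * (1 + 1) + 1) (p - 1, \<rho>, u) (-1, \<rho>, u)"
    using assms by simp
  have "runs w Fwd 1 (-1, \<rho>, u) (0, \<rho>, u)" using runs_Fwd[of w "-1" \<rho> u] by simp
  from runs_Seq[OF runs_Bwd runs_Seq[OF 1 this]] show ?thesis
    unfolding Rewind_def by (rule runs_mono) (use assms in auto)
qed

section \<open>Skipping encoded data\<close>

lemma word_contents_append:
  "word_contents (pre @ b # post) (int (length pre)) = (if b then 2 else 1)"
  by (simp add: word_contents_def)

lemma runs_Fwd': "p' = p + 1 \<Longrightarrow> runs w Fwd 1 (p, \<rho>, u) (p', \<rho>, u)"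
  using runs_Fwd by simp

text \<open>Symbol 2 is the bit \<open>True\<close>, by which \<open>enc_list\<close> announces an
  element; the loop stops on the closing \<open>False\<close>, not behind it. Three steps per symbol
  pay for a test, a move and one action on a register, the last of which is needed when elements are
  counted. The \<open>- 2\<close> reflects that the closing \<open>False\<close> costs only the
  failing test.\<close>

lemma runs_elems:
  assumes "\<And>x pre post \<rho>. x \<in> set xs \<Longrightarrow> runs (pre @ True # e x @ post) c (3 * length (e x) + 2)
    (int (length pre), \<rho>, u) (int (length pre + 1 + length (e x)), g \<rho>, u)"
  shows "runs (pre @ enc_list e xs @ post) (While (Reads {2}) c)
     (3 * length (enc_list e xs) - 2)
     (int (length pre), \<rho>, u)
     (int (length pre + length (enc_list e xs) - 1), (g ^^ length xs) \<rho>, u)"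
  using assms
proof (induction xs arbitrary: pre \<rho>)
  case Nil
  then show ?case
    using runs_WhileF[of "pre @ [False] @ post" "Reads {2}" "(int (length pre), \<rho>, u)"]
    by (simp add: word_contents_append)
next
  case (Cons x xs)
  let ?w = "pre @ enc_list e (x # xs) @ post" and ?n = "length (e x)"
  have pos: "length (enc_list e xs) > 0" by (cases xs) auto
  have "holds ?w (Reads {2}) (int (length pre), \<rho>, u)"
    by (simp add: word_contents_append)
  moreover have "runs ?w c (3 * ?n + 2) (int (length pre), \<rho>, u)
      (int (length pre + 1 + ?n), g \<rho>, u)"
    using Cons.prems[of x pre "enc_list e xs @ post"] by simp
  moreover have "runs ?w (While (Reads {2}) c) (3 * length (enc_list e xs) - 2)
     (int (length pre + 1 + ?n), g \<rho>, u)
     (int (length pre + length (enc_list e (x # xs)) - 1), (g ^^ length (x # xs)) \<rho>, u)"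
    using Cons.IH[of "pre @ True # e x" "g \<rho>"] Cons.prems
    by (simp add: algebra_simps funpow_swap1)
  ultimately have "runs ?w (While (Reads {2}) c)
     (1 + (3 * ?n + 2) + (3 * length (enc_list e xs) - 2)) (int (length pre), \<rho>, u)
     (int (length pre + length (enc_list e (x # xs)) - 1), (g ^^ length (x # xs)) \<rho>, u)"
    by (rule runs_WhileT)
  then show ?case by (rule runs_mono) (use pos in \<open>cases "length (enc_list e xs)"; simp\<close>)
qed

text \<open>The factor 3 is stable under nesting: if the elements of a list are scanned at this
  rate, so is the list. Hence one constant serves numbers, rows and tables.\<close>

definition scans :: "cmd \<Rightarrow> word \<Rightarrow> bool" where
  "scans c v \<longleftrightarrow> (\<forall>pre post \<rho> u. runs (pre @ v @ post) c (3 * length v)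
     (int (length pre), \<rho>, u) (int (length pre + length v), \<rho>, u))"

lemma scansD:
  "scans c v \<Longrightarrow> w = pre @ v @ post \<Longrightarrow> p = int (length pre) \<Longrightarrow> p' = int (length pre + length v) \<Longrightarrow>
     runs w c (3 * length v) (p, \<rho>, u) (p', \<rho>, u)"
  by (simp add: scans_def)

lemma enc_list_pos: "length (enc_list e xs) > 0"
  by (cases xs) auto

lemma scans_list:
  assumes "\<And>x pre post \<rho> u. x \<in> set xs \<Longrightarrow> runs (pre @ True # e x @ post) c (3 * length (e x) + 2)
    (int (length pre), \<rho>, u) (int (length pre + 1 + length (e x)), \<rho>, u)"
  shows "scans (While (Reads {2}) c ;; Fwd) (enc_list e xs)"
  unfolding scans_def
proof (intro allI)
  fix pre post :: word and \<rho> :: regs and u :: word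
  let ?w = "pre @ enc_list e xs @ post" and ?n = "length (enc_list e xs)"
  have "((\<lambda>\<rho>. \<rho>) ^^ k) \<rho> = \<rho>" for k by (induction k) auto
  then have "runs ?w (While (Reads {2}) c) (3 * ?n - 2) (int (length pre), \<rho>, u)
      (int (length pre + ?n - 1), \<rho>, u)"
    using runs_elems[of xs e c u "\<lambda>\<rho>. \<rho>" pre post \<rho>] assms by simp
  moreover have "runs ?w Fwd 1 (int (length pre + ?n - 1), \<rho>, u) (int (length pre + ?n), \<rho>, u)"
    using enc_list_pos[of e xs] by (intro runs_Fwd') linarith
  ultimately have "runs ?w (While (Reads {2}) c ;; Fwd) (3 * ?n - 2 + 1) (int (length pre), \<rho>, u)
      (int (length pre + ?n), \<rho>, u)"
    by (rule runs_Seq)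
  then show "runs ?w (While (Reads {2}) c ;; Fwd) (3 * ?n) (int (length pre), \<rho>, u)
      (int (length pre + ?n), \<rho>, u)"
    by (rule runs_mono) (use enc_list_pos[of e xs] in linarith)
qed

text \<open>A unary number is a list of units, so numbers fall under the same scanning lemmas as
  rows and tables.\<close>

lemma enc_nat_eq_enc_list: "enc_nat n = enc_list (\<lambda>_. []) (replicate n ())"
  by (induction n) (auto simp: enc_nat_def)

definition skip_nat :: cmd where
  "skip_nat = While (Reads {2}) Fwd ;; Fwd"

definition skip_row :: cmd where
  "skip_row = While (Reads {2}) (Fwd ;; skip_nat) ;; Fwd"

definition skip_table :: cmd where
  "skip_table = While (Reads {2}) (Fwd ;; skip_row) ;; Fwd"

lemma scans_nat: "scans skip_nat (enc_nat n)"
  unfolding skip_nat_def enc_nat_eq_enc_list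
  by (intro scans_list) (auto intro!: runs_mono[OF runs_Fwd'])

lemma runs_Fwd_scan:
  assumes "scans c v"
  shows "runs (pre @ b # v @ post) (Fwd ;; c) (1 + 3 * length v)
    (int (length pre), \<rho>, u) (int (length pre + 1 + length v), \<rho>, u)"
  by (rule runs_Seq[OF runs_Fwd scansD[OF assms, of _ "pre @ [b]" post]]) auto

lemma scans_row: "scans skip_row (enc_list enc_nat xs)"
  unfolding skip_row_def
  by (intro scans_list runs_mono[OF runs_Fwd_scan] scans_nat) auto

lemma scans_table: "scans skip_table (enc_table T)"
  unfolding skip_table_def
  by (intro scans_list runs_mono[OF runs_Fwd_scan] scans_row) auto

fun Seek :: "nat \<Rightarrow> cmd" where
  "Seek 0 = Rewind"
| "Seek (Suc k) = Seek k ;; skip_table"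

lemma enc_tables_split:
  "k < length Ts \<Longrightarrow> enc_tables Ts = enc_tables (take k Ts) @ enc_table (Ts ! k) @ enc_tables (drop (Suc k) Ts)"
  unfolding enc_tables_def by (subst id_take_nth_drop[of k Ts]) simp_all

lemma runs_Seek:
  "k \<le> length Ts \<Longrightarrow> runs (enc_tables Ts) (Seek k) ((2 + 3 * k) * length (enc_tables Ts) + 3) (0, \<rho>, u)
     (int (length (enc_tables (take k Ts))), \<rho>, u)"
proof (induction k)
  case 0
  then show ?case using runs_Rewind[of 0 "enc_tables Ts" \<rho> u] by (simp add: enc_tables_def)
next
  case (Suc k)
  let ?w = "enc_tables Ts"
  have "runs ?w skip_table (3 * length (enc_table (Ts ! k)))
     (int (length (enc_tables (take k Ts))), \<rho>, u) (int (length (enc_tables (take (Suc k) Ts))), \<rho>, u)"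
    using Suc.prems
    by (intro scansD[OF scans_table enc_tables_split]) (auto simp: take_Suc_conv_app_nth enc_tables_def)
  with Suc have "runs ?w (Seek (Suc k))
      ((2 + 3 * k) * length ?w + 3 + 3 * length (enc_table (Ts ! k))) (0, \<rho>, u)
      (int (length (enc_tables (take (Suc k) Ts))), \<rho>, u)"
    by (auto intro: runs_Seq)
  moreover have "length (enc_table (Ts ! k)) \<le> length ?w"
    using enc_tables_split[of k Ts] Suc.prems by simp
  ultimately show ?case by (elim runs_mono) (simp add: algebra_simps)
qed

section \<open>Reading an entry and counting rows\<close>

text \<open>Registers from 2 on are available to programs; register 1 is the loop counter of \<open>Look\<close>.\<close>

definition Look :: "nat \<Rightarrow> nat \<Rightarrow> nat \<Rightarrow> nat \<Rightarrow> cmd" where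
  "Look k i j d = Seek k ;; Rep i 1 (Fwd ;; skip_row) ;; Fwd ;; Rep j 1 (Fwd ;; skip_nat) ;; Fwd ;;
     While (Reads {2}) (Fwd ;; Inc d) ;; Rewind"

definition Count :: "nat \<Rightarrow> nat \<Rightarrow> cmd" where
  "Count k d = Seek k ;; While (Reads {2}) ((Fwd ;; skip_row) ;; Inc d) ;; Rewind"

text \<open>This is \<open>enc_list\<close> without its closing \<open>False\<close>: what precedes
  the head when it stands before a later element, and also what a loop emits when each round writes
  one element.\<close>

abbreviation elems :: "('a \<Rightarrow> word) \<Rightarrow> 'a list \<Rightarrow> word" where
  "elems e xs \<equiv> concat (map (\<lambda>x. True # e x) xs)"

lemma enc_list_split:
  "i < length xs \<Longrightarrow> enc_list e xs = elems e (take i xs) @ True # e (xs ! i) @ enc_list e (drop (Suc i) xs)"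
proof (induction xs arbitrary: i)
  case (Cons x xs)
  then show ?case by (cases i) auto
qed simp

lemma runs_Rep_elems:
  assumes "\<And>x. x \<in> set xs \<Longrightarrow> scans c (e x)" "\<rho> b \<le> length xs"
    and "b \<noteq> 0" "b \<noteq> 1" "\<rho> 0 = 0" "\<rho> 1 = 0"
    and w: "w = pre @ enc_list e xs @ post" and p: "p = int (length pre)"
    and p': "p' = int (length pre + length (elems e (take (\<rho> b) xs)))"
  shows "runs w (Rep b 1 (Fwd ;; c)) (\<rho> b * (1 + 3 * length w + 9) + 3) (p, \<rho>, u) (p', \<rho>, u)"
proof -
  let ?p = "\<lambda>i. int (length (pre @ elems e (take i xs)))"
  have "runs w (Fwd ;; c) (1 + 3 * length w) (?p i, \<rho>(1 := \<rho> b - 1 - i), u)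
      (?p (Suc i), \<rho>(1 := \<rho> b - 1 - i), u)" if "i < \<rho> b" for i
  proof -
    have i: "i < length xs" using that assms(2) by simp
    have w': "w = (pre @ elems e (take i xs)) @ True # e (xs ! i) @ enc_list e (drop (Suc i) xs) @ post"
      unfolding w by (subst enc_list_split[OF i]) simp
    have "scans c (e (xs ! i))" using assms(1) i by simp
    note scan = runs_Fwd_scan[OF this, of "pre @ elems e (take i xs)" True]
    have *: "runs w (Fwd ;; c) (1 + 3 * length (e (xs ! i))) (?p i, \<rho>(1 := \<rho> b - 1 - i), u)
      (int (length (pre @ elems e (take i xs)) + 1 + length (e (xs ! i))), \<rho>(1 := \<rho> b - 1 - i), u)"
      unfolding w' by (rule scan)
    have "int (length (pre @ elems e (take i xs)) + 1 + length (e (xs ! i))) = ?p (Suc i)"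
      using i by (simp add: take_Suc_conv_app_nth)
    with * have "runs w (Fwd ;; c) (1 + 3 * length (e (xs ! i))) (?p i, \<rho>(1 := \<rho> b - 1 - i), u)
      (?p (Suc i), \<rho>(1 := \<rho> b - 1 - i), u)" by (simp only:)
    moreover have "length (e (xs ! i)) \<le> length w" by (subst w') simp
    ultimately show ?thesis by (elim runs_mono) simp
  qed
  then have "runs w (Rep b 1 (Fwd ;; c)) (\<rho> b * (1 + 3 * length w + 9) + 3) (?p 0, \<rho>, u) (?p (\<rho> b), \<rho>, u)"
    using runs_Rep[of b 1 \<rho> "\<rho> b" w "Fwd ;; c" "1 + 3 * length w" ?p "\<lambda>_. \<rho>" "\<lambda>_. u"] assms(2-6)
    by simp
  then show ?thesis using p p' by simp
qed

text \<open>The entry stands in unary inside the input, so it is at most the input's length. This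
  keeps the registers bounded after a lookup, so that loops over the result remain
  polynomial.\<close>

lemma runs_Look:
  assumes "k < length Ts" "\<rho> i < length (Ts ! k)" "\<rho> j < length (Ts ! k ! \<rho> i)"
    and "i \<noteq> 0" "i \<noteq> 1" "j \<noteq> 0" "j \<noteq> 1" "\<rho> 0 = 0" "\<rho> 1 = 0" "\<rho> d = 0"
    and L: "L = length (enc_tables Ts)" and bnd: "\<rho> i \<le> L" "\<rho> j \<le> L"
  shows "Ts ! k ! \<rho> i ! \<rho> j \<le> L"
    and "runs (enc_tables Ts) (Look k i j d) ((2 + 3 * k) * L + 6 * L * L + 30 * L + 20)
      (0, \<rho>, u) (0, \<rho>(d := Ts ! k ! \<rho> i ! \<rho> j), u)"
proof -
  let ?w = "enc_tables Ts" and ?T = "Ts ! k" and ?r = "Ts ! k ! \<rho> i" and ?v = "Ts ! k ! \<rho> i ! \<rho> j"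
  \<comment> \<open>These are the parts of the input before the table, the row and the entry.
    \<open>p2\<close> and \<open>p3\<close> include the bit \<open>True\<close> that announces the
    row or the entry. The repetition ends on this bit, hence the positions
    \<open>length p2 - 1\<close> and \<open>length p3 - 1\<close> and the extra
    \<open>Fwd\<close>.\<close>
  define p1 where "p1 = enc_tables (take k Ts)"
  define p2 where "p2 = p1 @ elems (enc_list enc_nat) (take (\<rho> i) ?T) @ [True]"
  define p3 where "p3 = p2 @ elems enc_nat (take (\<rho> j) ?r) @ [True]"
  obtain q1 where w1: "?w = p1 @ enc_table ?T @ q1"
    using enc_tables_split[OF assms(1)] by (auto simp: p1_def)
  then obtain q2 where w2: "?w = p2 @ enc_list enc_nat ?r @ q2"
    using enc_list_split[OF assms(2), of "enc_list enc_nat"] by (auto simp: p2_def)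
  then obtain q3 where w3: "?w = p3 @ enc_nat ?v @ q3"
    using enc_list_split[OF assms(3), of enc_nat] by (auto simp: p3_def)
  show v: "?v \<le> L" using w3 by (simp add: L enc_nat_def)
  have a: "runs ?w (Seek k) ((2 + 3 * k) * L + 3) (0, \<rho>, u) (int (length p1), \<rho>, u)"
    unfolding p1_def L using assms(1) by (intro runs_Seek) simp
  have b: "runs ?w (Rep i 1 (Fwd ;; skip_row)) (L * (1 + 3 * L + 9) + 3)
      (int (length p1), \<rho>, u) (int (length p2 - 1), \<rho>, u)"
    by (rule runs_mono[OF runs_Rep_elems[OF scans_row _ _ _ _ _ w1]]) (use assms in \<open>auto simp: p2_def\<close>)
  have c: "runs ?w Fwd 1 (int (length p2 - 1), \<rho>, u) (int (length p2), \<rho>, u)"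
    by (rule runs_Fwd') (simp add: p2_def)
  have d: "runs ?w (Rep j 1 (Fwd ;; skip_nat)) (L * (1 + 3 * L + 9) + 3)
      (int (length p2), \<rho>, u) (int (length p3 - 1), \<rho>, u)"
    by (rule runs_mono[OF runs_Rep_elems[OF scans_nat _ _ _ _ _ w2]]) (use assms in \<open>auto simp: p3_def\<close>)
  have e: "runs ?w Fwd 1 (int (length p3 - 1), \<rho>, u) (int (length p3), \<rho>, u)"
    by (rule runs_Fwd') (simp add: p3_def)
  have "runs (pre @ True # post) (Fwd ;; Inc d) 2 (int (length pre), \<rho>', u) (int (length pre + 1), \<rho>'(d := \<rho>' d + 1), u)"
    for pre post \<rho>'
    by (rule runs_mono[OF runs_Seq[OF runs_Fwd' runs_Inc]]) auto
  then have "runs ?w (While (Reads {2}) (Fwd ;; Inc d)) (3 * length (enc_nat ?v) - 2)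
      (int (length p3), \<rho>, u) (int (length p3 + length (enc_nat ?v) - 1), ((\<lambda>\<rho>. \<rho>(d := \<rho> d + 1)) ^^ ?v) \<rho>, u)"
    unfolding w3
    using runs_elems[of "replicate ?v ()" "\<lambda>_. []" "Fwd ;; Inc d" u "\<lambda>\<rho>. \<rho>(d := \<rho> d + 1)" p3 q3 \<rho>]
    by (simp add: numeral_2_eq_2 flip: enc_nat_eq_enc_list)
  moreover have "((\<lambda>\<rho>. \<rho>(d := \<rho> d + 1)) ^^ n) \<rho> = \<rho>(d := \<rho> d + n)" for n
    by (induction n) auto
  ultimately have f: "runs ?w (While (Reads {2}) (Fwd ;; Inc d)) (3 * length (enc_nat ?v) - 2)
      (int (length p3), \<rho>, u) (int (length p3 + length (enc_nat ?v) - 1), \<rho>(d := ?v), u)"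
    using assms(10) by simp
  have g: "runs ?w Rewind (2 * L + 3) (int (length p3 + length (enc_nat ?v) - 1), \<rho>(d := ?v), u)
      (0, \<rho>(d := ?v), u)"
    unfolding L using arg_cong[OF w3, of length] by (intro runs_Rewind) auto
  show "runs ?w (Look k i j d) ((2 + 3 * k) * L + 6 * L * L + 30 * L + 20)
      (0, \<rho>, u) (0, \<rho>(d := ?v), u)"
    unfolding Look_def
    by (rule runs_mono[OF runs_Seq[OF a runs_Seq[OF b runs_Seq[OF c runs_Seq[OF d runs_Seq[OF e
      runs_Seq[OF f g]]]]]]]) (use v in \<open>simp add: algebra_simps enc_nat_def\<close>)
qed

lemma runs_Count:
  assumes "k < length Ts" "\<rho> d = 0" and L: "L = length (enc_tables Ts)"
  shows "length (Ts ! k) \<le> L"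
    and "runs (enc_tables Ts) (Count k d) ((2 + 3 * k) * L + 5 * L + 6)
      (0, \<rho>, u) (0, \<rho>(d := length (Ts ! k)), u)"
proof -
  let ?w = "enc_tables Ts" and ?T = "Ts ! k"
  define p1 where "p1 = enc_tables (take k Ts)"
  obtain q1 where w1: "?w = p1 @ enc_table ?T @ q1"
    using enc_tables_split[OF assms(1)] by (auto simp: p1_def)
  have "length xs \<le> length (enc_list e xs)" for xs and e :: "'a \<Rightarrow> word"
    by (induction xs) auto
  then show v: "length ?T \<le> L"
    using arg_cong[OF w1, of length] L by (metis le_add1 le_trans length_append trans_le_add2)
  have l: "length (enc_table ?T) \<le> L" using arg_cong[OF w1, of length] L by simp
  have a: "runs ?w (Seek k) ((2 + 3 * k) * L + 3) (0, \<rho>, u) (int (length p1), \<rho>, u)"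
    unfolding p1_def L using assms(1) by (intro runs_Seek) simp
  have "runs (pre @ True # enc_list enc_nat x @ post) ((Fwd ;; skip_row) ;; Inc d) (3 * length (enc_list enc_nat x) + 2)
      (int (length pre), \<rho>', u) (int (length pre + 1 + length (enc_list enc_nat x)), \<rho>'(d := \<rho>' d + 1), u)"
    for x pre post \<rho>'
    using runs_Seq[OF runs_Fwd_scan[OF scans_row] runs_Inc[OF refl]] by (rule runs_mono) simp
  then have "runs ?w (While (Reads {2}) ((Fwd ;; skip_row) ;; Inc d)) (3 * length (enc_table ?T) - 2)
      (int (length p1), \<rho>, u) (int (length p1 + length (enc_table ?T) - 1), ((\<lambda>\<rho>. \<rho>(d := \<rho> d + 1)) ^^ length ?T) \<rho>, u)"
    unfolding w1 by (rule runs_elems)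
  moreover have "((\<lambda>\<rho>. \<rho>(d := \<rho> d + 1)) ^^ n) \<rho> = \<rho>(d := \<rho> d + n)" for n
    by (induction n) auto
  ultimately have f: "runs ?w (While (Reads {2}) ((Fwd ;; skip_row) ;; Inc d)) (3 * length (enc_table ?T) - 2)
      (int (length p1), \<rho>, u) (int (length p1 + length (enc_table ?T) - 1), \<rho>(d := length ?T), u)"
    using assms(2) by simp
  have g: "runs ?w Rewind (2 * L + 3) (int (length p1 + length (enc_table ?T) - 1), \<rho>(d := length ?T), u)
      (0, \<rho>(d := length ?T), u)"
    unfolding L using arg_cong[OF w1, of length] by (intro runs_Rewind) auto
  show "runs ?w (Count k d) ((2 + 3 * k) * L + 5 * L + 6) (0, \<rho>, u) (0, \<rho>(d := length ?T), u)"
    unfolding Count_def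
    by (rule runs_mono[OF runs_Seq[OF a runs_Seq[OF f g]]]) (use l in \<open>simp add: algebra_simps\<close>)
qed


section \<open>Programs that run in polynomial time\<close>

definition poly_bounded :: "(nat \<Rightarrow> nat) \<Rightarrow> bool" where
  "poly_bounded f \<longleftrightarrow> (\<exists>q :: nat poly. \<forall>n. f n \<le> poly q n)"

lemma poly_bounded_const: "poly_bounded (\<lambda>_. c)"
  unfolding poly_bounded_def by (rule exI[of _ "[:c:]"]) simp

lemma poly_bounded_id: "poly_bounded (\<lambda>n. n)"
  unfolding poly_bounded_def by (rule exI[of _ "[:0, 1:]"]) simp

lemma poly_bounded_add: "poly_bounded f \<Longrightarrow> poly_bounded g \<Longrightarrow> poly_bounded (\<lambda>n. f n + g n)"
  unfolding poly_bounded_def by (metis add_mono poly_add)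

lemma poly_bounded_mult: "poly_bounded f \<Longrightarrow> poly_bounded g \<Longrightarrow> poly_bounded (\<lambda>n. f n * g n)"
  unfolding poly_bounded_def by (metis mult_le_mono poly_mult)

lemmas poly_bounded_intros =
  poly_bounded_const poly_bounded_id poly_bounded_add poly_bounded_mult

type_synonym precond = "table list \<Rightarrow> regs \<Rightarrow> bool"

text \<open>
  All the registers are bounded by the length of the input, so that a loop over the value of
  a register has polynomially many rounds.
\<close>

definition does :: "precond \<Rightarrow> cmd \<Rightarrow> (table list \<Rightarrow> regs \<Rightarrow> regs) \<Rightarrow> (table list \<Rightarrow> regs \<Rightarrow> word) \<Rightarrow> bool" where
  "does P c G u \<longleftrightarrow> (\<exists>f. poly_bounded f \<and>
     (\<forall>Ts \<rho> v. P Ts \<rho> \<longrightarrow> (\<forall>r. \<rho> r \<le> length (enc_tables Ts)) \<longrightarrow>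
        (\<forall>r. G Ts \<rho> r \<le> length (enc_tables Ts)) \<and>
        runs (enc_tables Ts) c (f (length (enc_tables Ts))) (0, \<rho>, v) (0, G Ts \<rho>, v @ u Ts \<rho>)))"

text \<open>All registers are restored at the end, so these programs can be put in sequence and into
  loops without tracking side effects.\<close>

abbreviation emits :: "precond \<Rightarrow> cmd \<Rightarrow> (table list \<Rightarrow> regs \<Rightarrow> word) \<Rightarrow> bool" where
  "emits P c u \<equiv> does P c (\<lambda>_ \<rho>. \<rho>) u"

abbreviation computes :: "precond \<Rightarrow> cmd \<Rightarrow> nat \<Rightarrow> (table list \<Rightarrow> regs \<Rightarrow> nat) \<Rightarrow> bool" where
  "computes P c d e \<equiv> does P c (\<lambda>Ts \<rho>. \<rho>(d := e Ts \<rho>)) (\<lambda>_ _. [])"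

lemma does_Seq:
  assumes "does P c G u" "does Q d H v" "\<And>Ts \<rho>. P Ts \<rho> \<Longrightarrow> Q Ts (G Ts \<rho>)"
  shows "does P (c ;; d) (\<lambda>Ts \<rho>. H Ts (G Ts \<rho>)) (\<lambda>Ts \<rho>. u Ts \<rho> @ v Ts (G Ts \<rho>))"
proof -
  from assms(1) obtain f where f: "poly_bounded f"
      "\<And>Ts \<rho> w. P Ts \<rho> \<Longrightarrow> (\<forall>r. \<rho> r \<le> length (enc_tables Ts)) \<Longrightarrow>
        (\<forall>r. G Ts \<rho> r \<le> length (enc_tables Ts)) \<and>
        runs (enc_tables Ts) c (f (length (enc_tables Ts))) (0, \<rho>, w) (0, G Ts \<rho>, w @ u Ts \<rho>)"
    unfolding does_def by blast
  from assms(2) obtain g where g: "poly_bounded g"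
      "\<And>Ts \<rho> w. Q Ts \<rho> \<Longrightarrow> (\<forall>r. \<rho> r \<le> length (enc_tables Ts)) \<Longrightarrow>
        (\<forall>r. H Ts \<rho> r \<le> length (enc_tables Ts)) \<and>
        runs (enc_tables Ts) d (g (length (enc_tables Ts))) (0, \<rho>, w) (0, H Ts \<rho>, w @ v Ts \<rho>)"
    unfolding does_def by blast
  show ?thesis unfolding does_def
  proof (intro exI conjI allI impI)
    show "poly_bounded (\<lambda>n. f n + g n)" using f(1) g(1) by (rule poly_bounded_add)
    fix Ts \<rho> w
    assume A: "P Ts \<rho>" "\<forall>r. \<rho> r \<le> length (enc_tables Ts)"
    note f' = f(2)[OF this]
    note g' = g(2)[OF assms(3)[OF A(1)] conjunct1[OF f']]
    show "H Ts (G Ts \<rho>) r \<le> length (enc_tables Ts)" for r using g' by blast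
    show "runs (enc_tables Ts) (c ;; d) (f (length (enc_tables Ts)) + g (length (enc_tables Ts)))
        (0, \<rho>, w) (0, H Ts (G Ts \<rho>), w @ u Ts \<rho> @ v Ts (G Ts \<rho>))"
      using runs_Seq[OF conjunct2[OF f'] conjunct2[OF g']] by simp
  qed
qed

lemma does_cong:
  assumes "does P c G u" "\<And>Ts \<rho>. P' Ts \<rho> \<Longrightarrow> P Ts \<rho>"
    and "\<And>Ts \<rho>. P' Ts \<rho> \<Longrightarrow> G Ts \<rho> = G' Ts \<rho>" "\<And>Ts \<rho>. P' Ts \<rho> \<Longrightarrow> u Ts \<rho> = u' Ts \<rho>"
  shows "does P' c G' u'"
proof -
  from assms(1) obtain f where f: "poly_bounded f"
    "\<And>Ts \<rho> v. P Ts \<rho> \<Longrightarrow> \<forall>r. \<rho> r \<le> length (enc_tables Ts) \<Longrightarrow>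
       (\<forall>r. G Ts \<rho> r \<le> length (enc_tables Ts)) \<and>
       runs (enc_tables Ts) c (f (length (enc_tables Ts))) (0, \<rho>, v) (0, G Ts \<rho>, v @ u Ts \<rho>)"
    unfolding does_def by blast
  show ?thesis unfolding does_def
  proof (intro exI[of _ f] conjI[OF f(1)] allI impI)
    fix Ts \<rho> v
    assume A: "P' Ts \<rho>" "\<forall>r. \<rho> r \<le> length (enc_tables Ts)"
    from f(2)[OF assms(2)[OF A(1)] A(2), of v] assms(3,4)[OF A(1)]
    show "(\<forall>r. G' Ts \<rho> r \<le> length (enc_tables Ts)) \<and>
       runs (enc_tables Ts) c (f (length (enc_tables Ts))) (0, \<rho>, v) (0, G' Ts \<rho>, v @ u' Ts \<rho>)"
      by simp
  qed
qed

lemma emits_Seq: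
  "emits P c u \<Longrightarrow> emits P d v \<Longrightarrow> emits P (c ;; d) (\<lambda>Ts \<rho>. u Ts \<rho> @ v Ts \<rho>)"
  by (rule does_Seq)

lemma emits_Emit: "emits P (Emit b) (\<lambda>_ _. [b])"
  unfolding does_def
  by (intro exI[of _ "\<lambda>_. 1"] conjI allI impI poly_bounded_const runs_Emit) blast

lemma does_Dec:
  assumes "\<And>Ts \<rho>. P Ts \<rho> \<Longrightarrow> \<rho> d \<noteq> 0"
  shows "computes P (Dec d) d (\<lambda>_ \<rho>. \<rho> d - 1)"
  unfolding does_def
proof (intro exI[of _ "\<lambda>_. 1"] conjI allI impI poly_bounded_const)
  fix Ts \<rho> v r assume A: "P Ts \<rho>" "\<forall>r. \<rho> r \<le> length (enc_tables Ts)"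
  then show "(\<rho>(d := \<rho> d - 1)) r \<le> length (enc_tables Ts)"
    by (cases "r = d") (auto intro: order_trans[OF diff_le_self])
  show "runs (enc_tables Ts) (Dec d) 1 (0, \<rho>, v) (0, \<rho>(d := \<rho> d - 1), v @ [])"
    using assms[OF A(1)] by (simp only: append_Nil2) (rule runs_Dec, simp_all)
qed

lemma does_Copy:
  assumes "b \<noteq> k" "b \<noteq> 0" "k \<noteq> 0" "\<And>Ts \<rho>. P Ts \<rho> \<Longrightarrow> \<rho> k = 0 \<and> \<rho> 0 = 0"
  shows "computes P (Copy b k) k (\<lambda>_ \<rho>. \<rho> b)"
  unfolding does_def
proof (intro exI[of _ "\<lambda>n. 7 * n + 2"] conjI allI impI poly_bounded_intros)
  fix Ts \<rho> v r assume A: "P Ts \<rho>" "\<forall>r. \<rho> r \<le> length (enc_tables Ts)"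
  then show "(\<rho>(k := \<rho> b)) r \<le> length (enc_tables Ts)" by simp
  show "runs (enc_tables Ts) (Copy b k) (7 * length (enc_tables Ts) + 2) (0, \<rho>, v) (0, \<rho>(k := \<rho> b), v @ [])"
    using runs_mono[OF runs_Copy[of b k \<rho> "enc_tables Ts" 0 v]] assms A by simp
qed

lemma computes_Look:
  assumes "i \<notin> {0, 1}" "j \<notin> {0, 1}"
    and P: "\<And>Ts \<rho>. P Ts \<rho> \<Longrightarrow> k < length Ts \<and> \<rho> i < length (Ts ! k) \<and> \<rho> j < length (Ts ! k ! \<rho> i) \<and>
      \<rho> 0 = 0 \<and> \<rho> 1 = 0 \<and> \<rho> d = 0"
  shows "computes P (Look k i j d) d (\<lambda>Ts \<rho>. Ts ! k ! \<rho> i ! \<rho> j)"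
  unfolding does_def
proof (intro exI[of _ "\<lambda>L. (2 + 3 * k) * L + 6 * L * L + 30 * L + 20"] conjI allI impI poly_bounded_intros)
  fix Ts \<rho> v r assume A: "P Ts \<rho>" "\<forall>r. \<rho> r \<le> length (enc_tables Ts)"
  show "(\<rho>(d := Ts ! k ! \<rho> i ! \<rho> j)) r \<le> length (enc_tables Ts)"
    using A P[OF A(1)] runs_Look(1)[of k Ts \<rho> i j d] assms(1,2) by simp
  show "runs (enc_tables Ts) (Look k i j d) ((2 + 3 * k) * length (enc_tables Ts) +
      6 * length (enc_tables Ts) * length (enc_tables Ts) + 30 * length (enc_tables Ts) + 20)
      (0, \<rho>, v) (0, \<rho>(d := Ts ! k ! \<rho> i ! \<rho> j), v @ [])"
    using A P[OF A(1)] runs_Look(2)[of k Ts \<rho> i j d _ v] assms(1,2) by simp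
qed

lemma computes_Count:
  assumes P: "\<And>Ts \<rho>. P Ts \<rho> \<Longrightarrow> k < length Ts \<and> \<rho> d = 0"
  shows "computes P (Count k d) d (\<lambda>Ts _. length (Ts ! k))"
  unfolding does_def
proof (intro exI[of _ "\<lambda>L. (2 + 3 * k) * L + 5 * L + 6"] conjI allI impI poly_bounded_intros)
  fix Ts \<rho> v r assume A: "P Ts \<rho>" "\<forall>r. \<rho> r \<le> length (enc_tables Ts)"
  show "(\<rho>(d := length (Ts ! k))) r \<le> length (enc_tables Ts)"
    using A P[OF A(1)] runs_Count(1)[of k Ts \<rho> d] by simp
  show "runs (enc_tables Ts) (Count k d) ((2 + 3 * k) * length (enc_tables Ts) +
      5 * length (enc_tables Ts) + 6) (0, \<rho>, v) (0, \<rho>(d := length (Ts ! k)), v @ [])"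
    using A P[OF A(1)] runs_Count(2)[of k Ts \<rho> d _ v] by simp
qed

lemma does_Zero: "computes P (Zero d) d (\<lambda>_ _. 0)"
  unfolding does_def
proof (intro exI[of _ "\<lambda>L. L * (1 + 1) + 1"] conjI allI impI poly_bounded_intros)
  fix Ts \<rho> v r assume A: "P Ts \<rho>" "\<forall>r. \<rho> r \<le> length (enc_tables Ts)"
  then show "(\<rho>(d := 0)) r \<le> length (enc_tables Ts)" by simp
  have "\<rho> d * (1 + 1) + 1 \<le> length (enc_tables Ts) * (1 + 1) + 1"
    using A(2) by (intro add_mono mult_right_mono) auto
  with runs_mono[OF runs_Zero]
  show "runs (enc_tables Ts) (Zero d) (length (enc_tables Ts) * (1 + 1) + 1) (0, \<rho>, v) (0, \<rho>(d := 0), v @ [])"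
    by simp
qed

text \<open>
  The preconditions of the bodies are the strongest ones, so that they need not be
  spelled out when these rules are applied.
\<close>

lemma emits_let:
  assumes c: "computes P c d e"
    and body: "emits (\<lambda>Ts \<rho>'. \<exists>\<rho>. P Ts \<rho> \<and> \<rho>' = \<rho>(d := e Ts \<rho>)) body u"
    and P: "\<And>Ts \<rho>. P Ts \<rho> \<Longrightarrow> \<rho> d = 0"
  shows "emits P (c ;; body ;; Zero d) (\<lambda>Ts \<rho>. u Ts (\<rho>(d := e Ts \<rho>)))"
  by (rule does_cong[OF does_Seq[OF c does_Seq[OF body does_Zero[of "\<lambda>_ _. True"]]]])
    (auto simp: P fun_upd_idem)

lemma emits_For:
  assumes regs: "r \<notin> {0, b, k}" "b \<notin> {0, k}" "k \<noteq> 0"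
    and body: "emits (\<lambda>Ts \<rho>'. \<exists>\<rho> i. P Ts \<rho> \<and> i < \<rho> b \<and> \<rho>' = \<rho>(r := i, k := \<rho> b - 1 - i)) c u"
    and P: "\<And>Ts \<rho>. P Ts \<rho> \<Longrightarrow> \<rho> 0 = 0 \<and> \<rho> r = 0 \<and> \<rho> k = 0"
  shows "emits P (For r b k c)
    (\<lambda>Ts \<rho>. concat (map (\<lambda>i. u Ts (\<rho>(r := i, k := \<rho> b - 1 - i))) [0..<\<rho> b]))"
proof -
  let ?Q = "\<lambda>Ts \<rho>'. \<exists>\<rho> i. P Ts \<rho> \<and> i < \<rho> b \<and> \<rho>' = \<rho>(r := i, k := \<rho> b - 1 - i)"
  from body obtain f where f: "poly_bounded f"
    and run: "\<And>Ts \<rho> v. ?Q Ts \<rho> \<Longrightarrow> \<forall>r. \<rho> r \<le> length (enc_tables Ts) \<Longrightarrow>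
       runs (enc_tables Ts) c (f (length (enc_tables Ts))) (0, \<rho>, v) (0, \<rho>, v @ u Ts \<rho>)"
    unfolding does_def by (elim exE conjE) (rule that, assumption, simp only: simp_thms)
  show ?thesis unfolding does_def
  \<comment> \<open>The bounds of \<open>runs_Rep\<close> with \<open>f n + 1\<close> per round and
    of \<open>runs_Zero\<close>, where the input length n replaces the number of rounds.\<close>
  proof (intro exI[of _ "\<lambda>n. n * (f n + 1 + 9) + 3 + (n * (1 + 1) + 1)"] conjI allI impI poly_bounded_intros f)
    fix Ts \<rho> v
    assume A: "P Ts \<rho>" "\<forall>s. \<rho> s \<le> length (enc_tables Ts)"
    then show "\<rho> s \<le> length (enc_tables Ts)" for s by blast
    let ?w = "enc_tables Ts" and ?n = "\<rho> b"
    let ?R = "\<lambda>i. \<rho>(r := i)"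
    let ?u = "\<lambda>m. v @ concat (map (\<lambda>i. u Ts (\<rho>(r := i, k := ?n - 1 - i))) [0..<m])"
    have n: "?n \<le> length ?w" using A(2) by blast
    have "runs ?w (Rep b k (c ;; Inc r)) (?n * (f (length ?w) + 1 + 9) + 3) (0, \<rho>, ?u 0) (0, ?R ?n, ?u ?n)"
    proof (rule runs_Rep)
      fix i assume i: "i < ?n"
      have "(\<rho>(r := i, k := ?n - 1 - i)) s \<le> length ?w" for s
        using A(2)[rule_format, of s] i n by auto
      then have "runs ?w c (f (length ?w)) (0, (?R i)(k := ?n - 1 - i), ?u i)
          (0, (?R i)(k := ?n - 1 - i), ?u i @ u Ts ((?R i)(k := ?n - 1 - i)))"
        using A(1) i by (intro run) blast+
      moreover have "runs ?w (Inc r) 1 (0, (?R i)(k := ?n - 1 - i), ?u i @ u Ts ((?R i)(k := ?n - 1 - i)))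
          (0, (?R (Suc i))(k := ?n - 1 - i), ?u (Suc i))"
        using runs_Inc[of "(?R (Suc i))(k := ?n - 1 - i)" "(?R i)(k := ?n - 1 - i)" r] regs
        by (auto simp: fun_eq_iff)
      ultimately show "runs ?w (c ;; Inc r) (f (length ?w) + 1) (0, (?R i)(k := ?n - 1 - i), ?u i)
          (0, (?R (Suc i))(k := ?n - 1 - i), ?u (Suc i))"
        by (rule runs_Seq)
    qed (use regs P[OF A(1)] in \<open>auto simp: fun_upd_idem\<close>)
    moreover have "runs ?w (Zero r) (?n * (1 + 1) + 1) (0, ?R ?n, ?u ?n) (0, \<rho>, ?u ?n)"
      using runs_Zero[of ?w r "?R ?n" 0 "?u ?n"] P[OF A(1)] by (simp add: fun_upd_idem)
    ultimately have "runs ?w (For r b k c) (?n * (f (length ?w) + 1 + 9) + 3 + (?n * (1 + 1) + 1))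
        (0, \<rho>, ?u 0) (0, \<rho>, ?u ?n)"
      unfolding For_def by (rule runs_Seq)
    moreover have "?n * (f (length ?w) + 1 + 9) + 3 + (?n * (1 + 1) + 1) \<le>
        length ?w * (f (length ?w) + 1 + 9) + 3 + (length ?w * (1 + 1) + 1)"
      by (intro add_mono mult_right_mono n) simp_all
    ultimately have "runs ?w (For r b k c)
        (length ?w * (f (length ?w) + 1 + 9) + 3 + (length ?w * (1 + 1) + 1)) (0, \<rho>, ?u 0) (0, \<rho>, ?u ?n)"
      by (rule runs_mono)
    then show "runs ?w (For r b k c) (length ?w * (f (length ?w) + 1 + 9) + 3 + (length ?w * (1 + 1) + 1))
        (0, \<rho>, v) (0, \<rho>, v @ concat (map (\<lambda>i. u Ts (\<rho>(r := i, k := ?n - 1 - i))) [0..<?n]))"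
      by (simp only: upt_0 list.map concat.simps append_Nil2)
  qed
qed

lemma polytime_on_emits:
  assumes "emits P c u"
    and "\<And>x. x \<in> D \<Longrightarrow> \<exists>Ts. ea x = enc_tables Ts \<and> P Ts (\<lambda>_. 0) \<and> u Ts (\<lambda>_. 0) = eb (F x)"
  shows "polytime_on ea eb D F"
proof -
  obtain K where K: "uses_below K c" using ex_uses_below by blast
  from assms(1) obtain f where f: "poly_bounded f"
    "\<And>Ts \<rho> v. P Ts \<rho> \<Longrightarrow> \<forall>r. \<rho> r \<le> length (enc_tables Ts) \<Longrightarrow>
       runs (enc_tables Ts) c (f (length (enc_tables Ts))) (0, \<rho>, v) (0, \<rho>, v @ u Ts \<rho>)"
    unfolding does_def by blast
  from f(1) obtain q :: "nat poly" where q: "f n \<le> poly q n" for n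
    unfolding poly_bounded_def by blast
  \<comment> \<open>The constant 1 pays for the initial step that writes the marks.\<close>
  have "tm_computes_within (machine K c) (ea x) (eb (F x)) (poly (q + [:1:]) (length (ea x)))"
    if x: "x \<in> D" for x
  proof -
    obtain Ts where Ts: "ea x = enc_tables Ts" "P Ts (\<lambda>_. 0)" "u Ts (\<lambda>_. 0) = eb (F x)"
      using assms(2)[OF x] by blast
    from f(2)[OF Ts(2), of "[]"] Ts obtain t where
      t: "t \<le> f (length (ea x))" "exec (ea x) c (0, \<lambda>_. 0, []) t (0, \<lambda>_. 0, eb (F x))"
      by (auto simp: runs_def)
    have "t < poly (q + [:1:]) (length (ea x))" using t(1) q[of "length (ea x)"] by simp
    from machine_computes[OF t(2) K this] show ?thesis .
  qed
  then show ?thesis unfolding polytime_on_def using wf_machine[OF K] by blast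
qed


section \<open>The programs of the reduction\<close>

definition Unary :: "nat \<Rightarrow> cmd" where
  "Unary c = For 17 c 18 (Emit True)"

text \<open>No register ever holds a product: c times n is written by nested loops, register 3
  holding n. The leading \<open>True\<close> announces a list element and the final
  \<open>False\<close> closes its number.\<close>

definition Entry :: "nat \<Rightarrow> cmd \<Rightarrow> cmd" where
  "Entry c t = Emit True ;; For 17 c 18 (For 19 3 20 (Emit True)) ;; t ;; Emit False"

lemma concat_map_const: "concat (map (\<lambda>_. replicate m b) [0..<n]) = replicate (n * m) b"
  by (induction n) (auto simp: replicate_add[symmetric] add.commute)

lemma emits_cong:
  "emits P c u \<Longrightarrow> (\<And>Ts \<rho>. P Ts \<rho> \<Longrightarrow> u Ts \<rho> = v Ts \<rho>) \<Longrightarrow> emits P c v"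
  by (erule does_cong) simp_all

lemma emits_Unary:
  assumes "c \<notin> {0, 17, 18}" "\<And>Ts \<rho>. P Ts \<rho> \<Longrightarrow> \<rho> 0 = 0 \<and> \<rho> 17 = 0 \<and> \<rho> 18 = 0"
  shows "emits P (Unary c) (\<lambda>_ \<rho>. replicate (\<rho> c) True)"
  unfolding Unary_def
proof (rule emits_cong, rule emits_For[OF _ _ _ emits_Emit])
  show "concat (map (\<lambda>_. [True]) [0..<\<rho> c]) = replicate (\<rho> c) True" for \<rho> :: regs
    using concat_map_const[of 1] by simp
qed (use assms in auto)

lemma emits_Entry:
  assumes "emits P t u" "c \<notin> {0, 3, 17, 18, 19, 20}"
    and "\<And>Ts \<rho>. P Ts \<rho> \<Longrightarrow> \<rho> 0 = 0 \<and> \<rho> 17 = 0 \<and> \<rho> 18 = 0 \<and> \<rho> 19 = 0 \<and> \<rho> 20 = 0"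
  shows "emits P (Entry c t) (\<lambda>Ts \<rho>. True # replicate (\<rho> c * \<rho> 3) True @ u Ts \<rho> @ [False])"
  unfolding Entry_def
proof (rule emits_cong, rule emits_Seq[OF emits_Emit emits_Seq[OF _ emits_Seq[OF assms(1) emits_Emit]]])
  show "emits P (For 17 c 18 (For 19 3 20 (Emit True))) (\<lambda>_ \<rho>. replicate (\<rho> c * \<rho> 3) True)"
  proof (rule emits_cong, rule emits_For[OF _ _ _ emits_For[OF _ _ _ emits_Emit]])
    show "concat (map (\<lambda>i. concat (map (\<lambda>_. [True]) [0..<(\<rho>(17 := i, 18 := \<rho> c - 1 - i)) 3])) [0..<\<rho> c])
        = replicate (\<rho> c * \<rho> 3) True" for \<rho> :: regs
      using concat_map_const[of 1 True] concat_map_const[of "\<rho> 3" True "\<rho> c"] by simp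
  qed (use assms(2,3) in auto)
qed simp

text \<open>
  Register 2 holds \<open>m = length A\<close>, register 3 holds
  \<open>n = length B\<close> and register 4 holds \<open>n - 1\<close>. The loops use the registers 5, 7, 9 and 11
  together with the counters 6, 8, 10 and 12, which count down.
\<close>

definition product_cmd :: cmd where
  "product_cmd =
     Look 0 5 9 13 ;; (Look 2 7 11 14 ;; (Look 0 13 14 15 ;; (Look 1 7 11 16 ;;
       Entry 15 (Unary 16) ;;
     Zero 16) ;; Zero 15) ;; Zero 14) ;; Zero 13"

definition group_cmd :: cmd where
  "group_cmd = For 5 2 6 (For 7 3 8 (Emit True ;; For 9 2 10 (For 11 3 12 product_cmd) ;; Emit False)) ;;
     Emit False"

definition id_cmd :: cmd where
  "id_cmd = For 5 2 6 (For 7 3 8 (Entry 5 (Unary 7))) ;; Emit False"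

text \<open>As registers cannot be compared, the images under the transposition of 0 and i + 1 are
  written for four ranges: 0, then 1 to i, then i + 1, then the rest. Register 7 selects the block
  and register 5 holds i. Register 11 is 0 here, so \<open>Unary 11\<close> adds nothing to the
  start of the block. Register 6 is the counter of the loop over i in \<open>swaps_cmd\<close>; it
  holds n - 2 - i, the length of the last range.\<close>

definition swap_cmd :: cmd where
  "swap_cmd =
     Entry 7 (Unary 5 ;; Emit True) ;;
     For 9 5 10 (Entry 7 (Unary 9 ;; Emit True)) ;;
     Entry 7 (Unary 11) ;;
     For 9 6 10 (Entry 7 (Unary 5 ;; Unary 9 ;; Emit True ;; Emit True))"

definition swaps_cmd :: cmd where
  "swaps_cmd = For 5 4 6 (Emit True ;; For 7 2 8 swap_cmd ;; Emit False) ;; Emit False"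

definition forward_cmd :: cmd where
  "forward_cmd = Count 0 2 ;; (Count 1 3 ;; ((Copy 3 4 ;; Dec 4) ;;
     (group_cmd ;; group_cmd ;; id_cmd ;; swaps_cmd) ;; Zero 4) ;; Zero 3) ;; Zero 2"

text \<open>
  The solution \<open>Some (t, qs)\<close> has the same encoding as the table \<open>t # qs\<close>, so the input
  of the second program consists of four tables.
\<close>

definition backward_cmd :: cmd where
  "backward_cmd = Count 3 2 ;; (Count 1 3 ;;
     (For 5 2 6 (Emit True ;;
        For 7 3 8 (Look 3 5 7 13 ;; (Emit True ;; Unary 13 ;; Emit False) ;; Zero 13) ;;
        Emit False) ;;
      Emit False) ;; Zero 3) ;; Zero 2"

section \<open>The functions to be computed\<close>

definition is_matrix :: "nat \<Rightarrow> nat \<Rightarrow> nat \<Rightarrow> table \<Rightarrow> bool" where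
  "is_matrix k l b T \<longleftrightarrow> length T = k \<and> (\<forall>i<k. length (T ! i) = l \<and> (\<forall>j<l. T ! i ! j < b))"

text \<open>The pair \<open>(a, x)\<close> is represented by the number \<open>a * length B + x\<close>.\<close>

definition central_ext :: "table \<Rightarrow> table \<Rightarrow> table \<Rightarrow> nat \<Rightarrow> nat \<Rightarrow> nat" where
  "central_ext A B f i j = (let n = length B in
     A ! (A ! (i div n) ! (j div n)) ! (f ! (i mod n) ! (j mod n)) * n + B ! (i mod n) ! (j mod n))"

definition ext_table :: "table \<Rightarrow> table \<Rightarrow> table \<Rightarrow> table" where
  "ext_table A B f = (let N = length A * length B in
     map (\<lambda>i. map (\<lambda>j. central_ext A B f i j) [0..<N]) [0..<N])"

definition swap_list :: "nat \<Rightarrow> nat \<Rightarrow> nat \<Rightarrow> nat list" where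
  "swap_list m n i =
     map (\<lambda>j. (j div n) * n + Transposition.transpose 0 (Suc i) (j mod n)) [0..<m * n]"

definition forward :: "bi_inst \<Rightarrow> gris_inst" where
  "forward = (\<lambda>(A, B, f). let G = ext_table A B f; m = length A; n = length B in
     (G, G, [0..<m * n], map (swap_list m n) [0..<n - 1]))"

text \<open>What the programs rely on: every lookup stays inside its table, also when its indices
  were looked up themselves, and n - 1 can be formed by \<open>Dec\<close>.\<close>

definition tables_ok :: "table list \<Rightarrow> bool" where
  "tables_ok Ts \<longleftrightarrow> (\<exists>A B f. Ts = [A, B, f] \<and> length B > 0 \<and> is_matrix (length A) (length A) (length A) A \<and>
     is_matrix (length B) (length B) (length B) B \<and> is_matrix (length B) (length B) (length A) f)"

text \<open>The registers from k on are free; inside loops the precondition is used with a larger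
  k.\<close>

definition regs_ok :: "nat \<Rightarrow> precond" where
  "regs_ok k Ts \<rho> \<longleftrightarrow> tables_ok Ts \<and> \<rho> 2 = length (Ts ! 0) \<and> \<rho> 3 = length (Ts ! 1) \<and> \<rho> 4 = length (Ts ! 1) - 1 \<and>
     \<rho> 0 = 0 \<and> \<rho> 1 = 0 \<and> (\<forall>r\<ge>k. \<rho> r = 0)"

section \<open>Correctness of the programs\<close>

text \<open>The nested loops over a and x meet the numbers a * n + x in increasing order, one block
  of n for each a.\<close>

lemma elems_product:
  "elems e (map (\<lambda>i. h (i div n) (i mod n)) [0..<m * n])
     = concat (map (\<lambda>a. concat (map (\<lambda>x. True # e (h a x)) [0..<n])) [0..<m])"
proof (induction m)
  case (Suc m)
  have "[0..<Suc m * n] = [0..<m * n] @ map (\<lambda>x. x + m * n) [0..<n]"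
    using upt_add_eq_append[of 0 "m * n" n] by (simp add: map_add_upt add.commute)
  moreover have "map (\<lambda>i. h (i div n) (i mod n)) (map (\<lambda>x. x + m * n) [0..<n]) = map (h m) [0..<n]"
    by (auto simp: div_mult_self3)
  ultimately have "map (\<lambda>i. h (i div n) (i mod n)) [0..<Suc m * n] =
      map (\<lambda>i. h (i div n) (i mod n)) [0..<m * n] @ map (h m) [0..<n]"
    by (simp only: map_append)
  with Suc show ?case by (simp add: o_def)
qed simp

lemma enc_list_elems: "enc_list e xs = elems e xs @ [False]"
  by (induction xs) auto

text \<open>Resolved backwards along a program, these rules build the word that it emits. In the
  proofs below \<open>emits_cong\<close> leaves this word open, register conditions follow from the
  preconditions and loop ranges, and the equation with the intended word remains.\<close>

lemmas emits_intros = emits_let computes_Look computes_Count emits_For emits_Entry emits_Unary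
  emits_Seq emits_Emit

lemma emits_weaken:
  "emits Q c u \<Longrightarrow> (\<And>Ts \<rho>. P Ts \<rho> \<Longrightarrow> Q Ts \<rho>) \<Longrightarrow> emits P c u"
  by (erule does_cong) simp_all

text \<open>For (a, x) in registers 5, 7 and (b, y) in registers 9, 11, the lookups put a + b into
  13, f x y into 14, their sum into 15 and x + y into 16.\<close>

lemma emits_product:
  "emits (\<lambda>Ts \<rho>. regs_ok 13 Ts \<rho> \<and> \<rho> 5 < \<rho> 2 \<and> \<rho> 7 < \<rho> 3 \<and> \<rho> 9 < \<rho> 2 \<and> \<rho> 11 < \<rho> 3) product_cmd
     (\<lambda>Ts \<rho>. True # enc_nat (central_ext (Ts ! 0) (Ts ! 1) (Ts ! 2)
       (\<rho> 5 * length (Ts ! 1) + \<rho> 7) (\<rho> 9 * length (Ts ! 1) + \<rho> 11)))"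
  unfolding product_cmd_def
proof (rule emits_cong,
    (rule emits_intros | (clarsimp simp: regs_ok_def tables_ok_def is_matrix_def; fail))+, goal_cases)
  case (1 Ts \<rho>)
  then show ?case by (auto simp: regs_ok_def central_ext_def enc_nat_def replicate_add Let_def)
qed

lemma emits_group:
  "emits (regs_ok 5) group_cmd (\<lambda>Ts _. enc_table (ext_table (Ts ! 0) (Ts ! 1) (Ts ! 2)))"
proof -
  have row: "emits (\<lambda>Ts \<rho>. regs_ok 9 Ts \<rho> \<and> \<rho> 5 < \<rho> 2 \<and> \<rho> 7 < \<rho> 3)
      (For 9 2 10 (For 11 3 12 product_cmd) ;; Emit False)
      (\<lambda>Ts \<rho>. enc_list enc_nat (map (central_ext (Ts ! 0) (Ts ! 1) (Ts ! 2) (\<rho> 5 * length (Ts ! 1) + \<rho> 7))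
         [0..<length (Ts ! 0) * length (Ts ! 1)]))"
  proof (rule emits_cong,
    (rule emits_weaken[OF emits_product] emits_intros | (clarsimp simp: regs_ok_def; fail))+, goal_cases)
    case (1 Ts \<rho>)
    then show ?case
      using elems_product[of enc_nat "\<lambda>b y. central_ext (Ts ! 0) (Ts ! 1) (Ts ! 2)
          (\<rho> 5 * length (Ts ! 1) + \<rho> 7) (b * length (Ts ! 1) + y)" "length (Ts ! 1)" "length (Ts ! 0)"]
      by (simp add: regs_ok_def enc_list_elems o_def)
  qed
  show ?thesis unfolding group_cmd_def
  proof (rule emits_cong,
    (rule emits_weaken[OF row] emits_intros | (clarsimp simp: regs_ok_def; fail))+, goal_cases)
    case (1 Ts \<rho>)
    then show ?case
      using elems_product[of "enc_list enc_nat" "\<lambda>a x. map (central_ext (Ts ! 0) (Ts ! 1) (Ts ! 2)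
          (a * length (Ts ! 1) + x)) [0..<length (Ts ! 0) * length (Ts ! 1)]" "length (Ts ! 1)" "length (Ts ! 0)"]
      by (simp add: regs_ok_def enc_list_elems[of "enc_list enc_nat"] o_def ext_table_def Let_def)
  qed
qed

lemma emits_id:
  "emits (regs_ok 5) id_cmd (\<lambda>Ts _. enc_list enc_nat [0..<length (Ts ! 0) * length (Ts ! 1)])"
  unfolding id_cmd_def
proof (rule emits_cong,
    (rule emits_intros | (clarsimp simp: regs_ok_def; fail))+, goal_cases)
  case (1 Ts \<rho>)
  then show ?case
    using elems_product[of enc_nat "\<lambda>a x. a * length (Ts ! 1) + x" "length (Ts ! 1)" "length (Ts ! 0)"]
    by (simp add: regs_ok_def enc_list_elems enc_nat_def replicate_add)
qed

text \<open>The partition behind the four parts of \<open>swap_cmd\<close>, with n = i + 2 +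
  k.\<close>

lemma upt_split_swap: "[0..<i + 2 + k] = 0 # map Suc [0..<i] @ Suc i # map (\<lambda>x. i + 2 + x) [0..<k]"
proof -
  have "[0..<i + 2 + k] = 0 # [Suc 0..<i + 2 + k]" by (simp add: upt_conv_Cons del: upt_Suc)
  also have "[Suc 0..<i + 2 + k] = [Suc 0..<Suc i] @ [Suc i..<i + 2 + k]"
    using upt_add_eq_append[of "Suc 0" "Suc i" "1 + k"] by (simp del: upt_Suc)
  also have "[Suc i..<i + 2 + k] = Suc i # [i + 2..<i + 2 + k]"
    by (simp add: upt_conv_Cons del: upt_Suc)
  also have "[i + 2..<i + 2 + k] = map (\<lambda>x. i + 2 + x) [0..<k]"
    using map_add_upt[of "i + 2" k] by (simp add: add.commute)
  finally show ?thesis by (simp add: map_Suc_upt del: upt_Suc)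
qed

lemma emits_swap:
  "emits (\<lambda>Ts \<rho>. regs_ok 9 Ts \<rho> \<and> \<rho> 5 + 2 + \<rho> 6 = \<rho> 3) swap_cmd
     (\<lambda>Ts \<rho>. elems enc_nat (map (\<lambda>x. \<rho> 7 * \<rho> 3 + Transposition.transpose 0 (Suc (\<rho> 5)) x) [0..<\<rho> 3]))"
  unfolding swap_cmd_def
proof (rule emits_cong,
    (rule emits_intros | (clarsimp simp: regs_ok_def; fail))+, goal_cases)
  case (1 Ts \<rho>)
  let ?c = "\<rho> 7 * \<rho> 3"
  have "[0..<\<rho> 3] = 0 # map Suc [0..<\<rho> 5] @ Suc (\<rho> 5) # map (\<lambda>x. \<rho> 5 + 2 + x) [0..<\<rho> 6]"
    using 1 upt_split_swap by metis
  then have "map (\<lambda>x. ?c + Transposition.transpose 0 (Suc (\<rho> 5)) x) [0..<\<rho> 3]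
      = (?c + Suc (\<rho> 5)) # map (\<lambda>x. ?c + Suc x) [0..<\<rho> 5] @ ?c # map (\<lambda>x. ?c + Suc (Suc (\<rho> 5 + x))) [0..<\<rho> 6]"
    by (auto simp: Transposition.transpose_def)
  then show ?case using 1
    by (simp add: regs_ok_def enc_nat_def replicate_add replicate_app_Cons_same o_def del: upt_Suc)
qed

lemma emits_swaps:
  "emits (regs_ok 5) swaps_cmd
     (\<lambda>Ts _. enc_table (map (swap_list (length (Ts ! 0)) (length (Ts ! 1))) [0..<length (Ts ! 1) - 1]))"
  unfolding swaps_cmd_def
\<comment> \<open>The case with \<open>linarith\<close> is for the equation on registers 5, 6 and 3
  required by \<open>emits_swap\<close>: in round i the counter 6 holds (n - 1) - 1 - i.\<close>
proof (rule emits_cong,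
    (rule emits_weaken[OF emits_swap] emits_intros | (clarsimp simp: regs_ok_def; fail) |
      (clarsimp simp: regs_ok_def, linarith))+, goal_cases)
  case (1 Ts \<rho>)
  have "concat (map (\<lambda>a. elems (\<lambda>x. enc_nat (a * length (Ts ! 1) + Transposition.transpose 0 (Suc i) x))
      [0..<length (Ts ! 1)]) [0..<length (Ts ! 0)]) @ [False]
    = enc_list enc_nat (swap_list (length (Ts ! 0)) (length (Ts ! 1)) i)" for i
    unfolding swap_list_def enc_list_elems by (subst elems_product) simp
  with 1 show ?case
    by (simp add: regs_ok_def enc_list_elems[of "enc_list enc_nat"] o_def)
qed

lemma computes_pred:
  assumes "\<And>Ts \<rho>. P Ts \<rho> \<Longrightarrow> \<rho> 0 = 0 \<and> \<rho> 4 = 0 \<and> \<rho> 3 \<noteq> 0"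
  shows "computes P (Copy 3 4 ;; Dec 4) 4 (\<lambda>_ \<rho>. \<rho> 3 - 1)"
proof -
  have dec: "computes (\<lambda>Ts \<rho>. \<rho> 4 \<noteq> 0) (Dec 4) 4 (\<lambda>_ \<rho>. \<rho> 4 - 1)" by (rule does_Dec)
  have copy: "computes P (Copy 3 4) 4 (\<lambda>_ \<rho>. \<rho> 3)" using assms by (intro does_Copy) auto
  show ?thesis
    by (rule does_cong[OF does_Seq[OF copy dec]]) (auto simp: assms)
qed

definition forward_pre :: precond where
  "forward_pre Ts \<rho> \<longleftrightarrow> tables_ok Ts \<and> \<rho> = (\<lambda>_. 0)"

lemma emits_forward:
  "emits forward_pre forward_cmd (\<lambda>Ts _. enc_inst GRIS (forward (Ts ! 0, Ts ! 1, Ts ! 2)))"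
  unfolding forward_cmd_def
proof (rule emits_cong,
    (rule emits_weaken[OF emits_group] emits_weaken[OF emits_id] emits_weaken[OF emits_swaps]
      computes_pred emits_intros
      | (clarsimp simp: regs_ok_def forward_pre_def; fail) | (clarsimp simp: forward_pre_def tables_ok_def; fail))+, goal_cases)
  case (1 Ts \<rho>)
  then show ?case by (simp add: GRIS_def forward_def Let_def enc_pair_def)
qed

text \<open>The rows of table 3 are permutations of m * n numbers, of which only the first n values
  are read; a lower bound on their lengths keeps the lookups in range.\<close>

definition backward_pre :: precond where
  "backward_pre Ts \<rho> \<longleftrightarrow> length Ts = 4 \<and> (\<forall>i<length (Ts ! 3). length (Ts ! 1) \<le> length (Ts ! 3 ! i)) \<and> \<rho> = (\<lambda>_. 0)"

lemma emits_backward: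
  "emits backward_pre backward_cmd (\<lambda>Ts _. enc_table (map (take (length (Ts ! 1))) (Ts ! 3)))"
  unfolding backward_cmd_def
proof (rule emits_cong,
    (rule emits_intros | (clarsimp simp: backward_pre_def; fail) |
      (clarsimp simp: backward_pre_def, meson less_le_trans))+, goal_cases)
  case (1 Ts \<rho>)
  let ?n = "length (Ts ! 1)"
  have "elems (\<lambda>j. enc_nat (q ! j)) [0..<?n] @ [False] = enc_list enc_nat (take ?n q)"
    if "q \<in> set (Ts ! 3)" for q
  proof -
    have "take ?n q = map ((!) q) [0..<?n]"
      using 1 that by (intro nth_equalityI) (auto simp: backward_pre_def in_set_conv_nth)
    then show ?thesis by (simp add: enc_list_elems o_def)
  qed
  then have "elems (\<lambda>i. elems (\<lambda>j. enc_nat (Ts ! 3 ! i ! j)) [0..<?n] @ [False]) [0..<length (Ts ! 3)]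
      = elems (\<lambda>i. enc_list enc_nat (take ?n (Ts ! 3 ! i))) [0..<length (Ts ! 3)]"
    by (intro arg_cong[of _ _ concat] map_cong refl) simp
  also have "\<dots> @ [False] = enc_table (map (take ?n) (map ((!) (Ts ! 3)) [0..<length (Ts ! 3)]))"
    unfolding enc_list_elems[of "enc_list enc_nat"] by (simp add: o_def)
  finally show ?case using 1
    by (simp add: backward_pre_def map_nth enc_nat_def[abs_def])
qed


section \<open>The central extension defined by a bilinear map\<close>

lemma carrier_table_group [simp]: "carrier (table_group T) = {..<length T}"
  and mult_table_group [simp]: "x \<otimes>\<^bsub>table_group T\<^esub> y = T ! x ! y"
  by (simp_all add: table_group_def)

lemma is_group_tableI:
  assumes rows: "\<And>r. r \<in> set T \<Longrightarrow> length r = length T"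
    and closed: "\<And>x y. x < length T \<Longrightarrow> y < length T \<Longrightarrow> T ! x ! y < length T"
    and assoc: "\<And>x y z. x < length T \<Longrightarrow> y < length T \<Longrightarrow> z < length T \<Longrightarrow>
      T ! (T ! x ! y) ! z = T ! x ! (T ! y ! z)"
    and e: "e < length T" "\<And>x. x < length T \<Longrightarrow> T ! e ! x = x \<and> T ! x ! e = x"
    and inv: "\<And>x. x < length T \<Longrightarrow> \<exists>y<length T. T ! y ! x = e"
  shows "is_group_table T"
proof -
  have "(THE e. e < length T \<and> (\<forall>x<length T. T ! e ! x = x \<and> T ! x ! e = x)) = e"
  proof (rule the_equality)
    fix e' assume "e' < length T \<and> (\<forall>x<length T. T ! e' ! x = x \<and> T ! x ! e' = x)"
    with e show "e' = e" by metis
  qed (use e in blast)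
  then have one: "\<one>\<^bsub>table_group T\<^esub> = e" by (simp add: table_group_def)
  have "group (table_group T)"
    by (rule groupI) (use closed assoc e inv in \<open>auto simp: one Bex_def\<close>)
  with rows show ?thesis by (simp add: is_group_table_def)
qed

lemma group_table_is_matrix:
  assumes "is_group_table T"
  shows "is_matrix (length T) (length T) (length T) T"
proof -
  interpret group "table_group T" using assms by (simp add: is_group_table_def)
  show ?thesis using assms m_closed by (auto simp: is_matrix_def is_group_table_def)
qed

lemma div_mod_encode [simp]:
  assumes "x < (n :: nat)"
  shows "(a * n + x) div n = a" "(a * n + x) mod n = x"
  using assms by simp_all

lemma encode_less: "a < m \<Longrightarrow> x < n \<Longrightarrow> a * n + x < m * (n :: nat)"
  by (metis add_lessD1 div_less_iff_less_mult div_mod_encode(1) gr_implies_not0 neq0_conv)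

lemma decode_less: "i < m * n \<Longrightarrow> i div n < m \<and> i mod n < (n :: nat)"
  by (cases "n = 0") (auto simp: less_mult_imp_div_less)

lemma encode_eqI: "i div n = j div n \<Longrightarrow> i mod n = j mod n \<Longrightarrow> i = (j :: nat)"
  by (metis div_mult_mod_eq)

locale bi_instance =
  fixes A B f :: table
  assumes inst: "(A, B, f) \<in> BI_instances"
begin

abbreviation "m \<equiv> length A"
abbreviation "n \<equiv> length B"
abbreviation "N \<equiv> m * n"
abbreviation "GA \<equiv> table_group A"
abbreviation "GB \<equiv> table_group B"
abbreviation "G \<equiv> ext_table A B f"
abbreviation "isoms \<equiv> isometries GB (\<lambda>x y. f ! x ! y)"

sublocale A: comm_group GA using inst by (simp add: BI_instances_def)
sublocale B: comm_group GB using inst by (simp add: BI_instances_def)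

lemma f_bilinear: "bilinear_map GB GA (\<lambda>x y. f ! x ! y)"
  using inst by (simp add: BI_instances_def)

lemma f_closed: "x < n \<Longrightarrow> y < n \<Longrightarrow> f ! x ! y < m"
  using f_bilinear by (simp add: bilinear_map_def)

lemma f_mult:
  "x < n \<Longrightarrow> x' < n \<Longrightarrow> y < n \<Longrightarrow> f ! (B ! x ! x') ! y = A ! (f ! x ! y) ! (f ! x' ! y)"
  "x < n \<Longrightarrow> x' < n \<Longrightarrow> y < n \<Longrightarrow> f ! y ! (B ! x ! x') = A ! (f ! y ! x) ! (f ! y ! x')"
  using f_bilinear by (simp_all add: bilinear_map_def)

lemma A_closed: "a < m \<Longrightarrow> b < m \<Longrightarrow> A ! a ! b < m"
  using A.m_closed[of a b] by simp

lemma B_closed: "x < n \<Longrightarrow> y < n \<Longrightarrow> B ! x ! y < n"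
  using B.m_closed[of x y] by simp

lemma A_assoc: "a < m \<Longrightarrow> b < m \<Longrightarrow> c < m \<Longrightarrow> A ! (A ! a ! b) ! c = A ! a ! (A ! b ! c)"
  and A_comm: "a < m \<Longrightarrow> b < m \<Longrightarrow> A ! a ! b = A ! b ! a"
  and A_left_comm: "a < m \<Longrightarrow> b < m \<Longrightarrow> c < m \<Longrightarrow> A ! a ! (A ! b ! c) = A ! b ! (A ! a ! c)"
  using A.m_assoc[of a b c] A.m_comm[of a b] A.m_lcomm[of a b c] by simp_all

lemma one_less: "\<one>\<^bsub>GA\<^esub> < m" "\<one>\<^bsub>GB\<^esub> < n"
  using A.one_closed B.one_closed by simp_all

lemma n_pos: "n > 0"
  using one_less(2) by (rule le_less_trans[OF le0])

lemma m_pos: "m > 0"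
  using one_less(1) by (rule le_less_trans[OF le0])

lemma less_N: "x < n \<Longrightarrow> x < N"
  using encode_less[OF m_pos, of x n] by simp

text \<open>The unit of B is idempotent; by additivity so is the value of f, and the only idempotent
  of the group A is its unit.\<close>

lemma f_one: assumes "y < n" shows "f ! \<one>\<^bsub>GB\<^esub> ! y = \<one>\<^bsub>GA\<^esub>" "f ! y ! \<one>\<^bsub>GB\<^esub> = \<one>\<^bsub>GA\<^esub>"
proof -
  have "B ! \<one>\<^bsub>GB\<^esub> ! \<one>\<^bsub>GB\<^esub> = \<one>\<^bsub>GB\<^esub>" using B.l_one[OF B.one_closed] by simp
  with f_mult[of "\<one>\<^bsub>GB\<^esub>" "\<one>\<^bsub>GB\<^esub>" y] assms one_less
  have "f ! \<one>\<^bsub>GB\<^esub> ! y \<otimes>\<^bsub>GA\<^esub> f ! \<one>\<^bsub>GB\<^esub> ! y = f ! \<one>\<^bsub>GB\<^esub> ! y"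
    "f ! y ! \<one>\<^bsub>GB\<^esub> \<otimes>\<^bsub>GA\<^esub> f ! y ! \<one>\<^bsub>GB\<^esub> = f ! y ! \<one>\<^bsub>GB\<^esub>"
    by simp_all
  with f_closed assms one_less show "f ! \<one>\<^bsub>GB\<^esub> ! y = \<one>\<^bsub>GA\<^esub>" "f ! y ! \<one>\<^bsub>GB\<^esub> = \<one>\<^bsub>GA\<^esub>"
    by (simp_all del: mult_table_group)
qed

lemma length_G: "length G = N"
  by (simp add: ext_table_def Let_def)

lemma G_nth: "i < N \<Longrightarrow> j < N \<Longrightarrow> G ! i ! j = central_ext A B f i j"
  by (simp add: ext_table_def Let_def)

lemma G_decode:
  assumes "i < N" "j < N"
  shows "(G ! i ! j) div n = A ! (A ! (i div n) ! (j div n)) ! (f ! (i mod n) ! (j mod n))"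
    and "(G ! i ! j) mod n = B ! (i mod n) ! (j mod n)"
    and "G ! i ! j < N"
proof -
  let ?a = "A ! (A ! (i div n) ! (j div n)) ! (f ! (i mod n) ! (j mod n))"
  let ?x = "B ! (i mod n) ! (j mod n)"
  have "?a < m" "?x < n"
    using decode_less[OF assms(1)] decode_less[OF assms(2)] by (simp_all add: A_closed B_closed f_closed)
  moreover have "G ! i ! j = ?a * n + ?x" using G_nth[OF assms] by (simp add: central_ext_def Let_def)
  ultimately show "(G ! i ! j) div n = ?a" "(G ! i ! j) mod n = ?x" "G ! i ! j < N"
    by (simp_all add: encode_less)
qed

lemma group_table_G: "is_group_table G"
proof (rule is_group_tableI[where e = "\<one>\<^bsub>GA\<^esub> * n + \<one>\<^bsub>GB\<^esub>"])
  show "length r = length G" if "r \<in> set G" for r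
    using that by (auto simp: ext_table_def Let_def)
  show "G ! i ! j < length G" if "i < length G" "j < length G" for i j
    using that G_decode(3) by (simp add: length_G)
  show e: "\<one>\<^bsub>GA\<^esub> * n + \<one>\<^bsub>GB\<^esub> < length G"
    using one_less by (simp add: length_G encode_less)
next
  fix i assume "i < length G"
  then have i: "i < N" by (simp add: length_G)
  note d = decode_less[OF i]
  have e: "\<one>\<^bsub>GA\<^esub> * n + \<one>\<^bsub>GB\<^esub> < N" using one_less by (simp add: encode_less)
  have l: "A ! \<one>\<^bsub>GA\<^esub> ! a = a" "A ! a ! \<one>\<^bsub>GA\<^esub> = a" if "a < m" for a
    using A.l_one[of a] A.r_one[of a] that by simp_all
  have r: "B ! \<one>\<^bsub>GB\<^esub> ! a = a" "B ! a ! \<one>\<^bsub>GB\<^esub> = a" if "a < n" for a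
    using B.l_one[of a] B.r_one[of a] that by simp_all
  show "G ! (\<one>\<^bsub>GA\<^esub> * n + \<one>\<^bsub>GB\<^esub>) ! i = i \<and> G ! i ! (\<one>\<^bsub>GA\<^esub> * n + \<one>\<^bsub>GB\<^esub>) = i"
    using d one_less
    by (auto intro!: encode_eqI[of _ n i] simp: G_decode i e l r f_one)
  \<comment> \<open>The left inverse of (a, x) is (-(a + f (-x) x), -x).\<close>
  let ?x = "inv\<^bsub>GB\<^esub> (i mod n)"
  have x: "?x < n" "B ! ?x ! (i mod n) = \<one>\<^bsub>GB\<^esub>"
    using B.inv_closed[of "i mod n"] B.l_inv[of "i mod n"] d by simp_all
  define c where "c = f ! ?x ! (i mod n)"
  have c: "c < m" using x d by (simp add: c_def f_closed)
  let ?a = "inv\<^bsub>GA\<^esub> ((i div n) \<otimes>\<^bsub>GA\<^esub> c)"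
  have a: "?a < m" using A.inv_closed[OF A.m_closed[of "i div n" c]] c d by simp
  have "?a \<otimes>\<^bsub>GA\<^esub> (i div n) \<otimes>\<^bsub>GA\<^esub> c = \<one>\<^bsub>GA\<^esub>"
    using a c d A.m_assoc[of ?a "i div n" c] A.l_inv[OF A.m_closed[of "i div n" c]] by simp
  then have "A ! (A ! ?a ! (i div n)) ! c = \<one>\<^bsub>GA\<^esub>" by simp
  moreover have jN: "?a * n + ?x < N" using a x(1) by (rule encode_less)
  ultimately have "(G ! (?a * n + ?x) ! i) div n = \<one>\<^bsub>GA\<^esub>" "(G ! (?a * n + ?x) ! i) mod n = \<one>\<^bsub>GB\<^esub>"
    by (simp_all only: G_decode[OF jN i] div_mod_encode[OF x(1)] x(2) c_def[symmetric])
  then have "G ! (?a * n + ?x) ! i = \<one>\<^bsub>GA\<^esub> * n + \<one>\<^bsub>GB\<^esub>"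
    by (metis div_mult_mod_eq)
  then show "\<exists>j<length G. G ! j ! i = \<one>\<^bsub>GA\<^esub> * n + \<one>\<^bsub>GB\<^esub>"
    using encode_less[OF a x(1)] length_G by auto
next
  fix i j k assume "i < length G" "j < length G" "k < length G"
  then have ijk: "i < N" "j < N" "k < N" by (simp_all add: length_G)
  note d = decode_less[OF ijk(1)] decode_less[OF ijk(2)] decode_less[OF ijk(3)]
  \<comment> \<open>The cocycle identity: after expanding f by bilinearity, both first coordinates
    equal a + b + c + f x y + f x z + f y z.\<close>
  have "(G ! (G ! i ! j) ! k) div n = (G ! i ! (G ! j ! k)) div n"
    using d by (simp add: G_decode ijk f_mult A_closed f_closed A_assoc A_comm A_left_comm)
  moreover have "(G ! (G ! i ! j) ! k) mod n = (G ! i ! (G ! j ! k)) mod n"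
    using d B.m_assoc[of "i mod n" "j mod n" "k mod n"] by (simp add: G_decode ijk)
  ultimately show "G ! (G ! i ! j) ! k = G ! i ! (G ! j ! k)"
    by (rule encode_eqI)
qed

section \<open>Permutations of B acting on the extension\<close>

definition lift :: "(nat \<Rightarrow> nat) \<Rightarrow> nat \<Rightarrow> nat" where
  "lift \<gamma> = restrict (\<lambda>i. (i div n) * n + \<gamma> (i mod n)) {..<N}"

lemma Bij_less: "\<gamma> \<in> Bij {..<k} \<Longrightarrow> x < k \<Longrightarrow> \<gamma> x < k"
  using Bij_imp_funcset by blast

lemma lift_decode:
  assumes "\<gamma> \<in> Bij {..<n}" "i < N"
  shows "lift \<gamma> i div n = i div n" "lift \<gamma> i mod n = \<gamma> (i mod n)" "lift \<gamma> i < N"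
  using decode_less[OF assms(2)] Bij_less[OF assms(1), of "i mod n"] assms(2)
  by (simp_all add: lift_def encode_less)

text \<open>The numbers below n are the pairs with first coordinate 0, so the first n values of a
  lifted permutation are those of \<gamma>. This justifies the truncation in
  \<open>backward\<close>.\<close>

lemma lift_low: "x < n \<Longrightarrow> lift \<gamma> x = \<gamma> x"
  using less_N[of x] by (simp add: lift_def)

lemma lift_compose:
  assumes "\<gamma> \<in> Bij {..<n}" "\<gamma>' \<in> Bij {..<n}"
  shows "lift (compose {..<n} \<gamma> \<gamma>') = compose {..<N} (lift \<gamma>) (lift \<gamma>')"
proof
  fix i
  show "lift (compose {..<n} \<gamma> \<gamma>') i = compose {..<N} (lift \<gamma>) (lift \<gamma>') i"
  proof (cases "i < N")
    case True
    have "lift \<gamma> (lift \<gamma>' i) = (i div n) * n + \<gamma> (\<gamma>' (i mod n))"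
      using lift_decode[OF assms(2) True] by (simp add: lift_def[of \<gamma>])
    with True decode_less[OF True] show ?thesis
      by (simp add: lift_def[of "compose _ _ _"] compose_eq)
  qed (simp add: lift_def compose_def)
qed

lemma lift_Bij:
  assumes "\<gamma> \<in> Bij {..<n}"
  shows "lift \<gamma> \<in> Bij {..<N}"
proof -
  have bij: "bij_betw \<gamma> {..<n} {..<n}" using assms by (simp add: Bij_def)
  have "inj_on (lift \<gamma>) {..<N}"
  proof (rule inj_onI)
    fix i j assume ij: "i \<in> {..<N}" "j \<in> {..<N}" "lift \<gamma> i = lift \<gamma> j"
    then have d: "i div n = j div n" and "\<gamma> (i mod n) = \<gamma> (j mod n)"
      using lift_decode[OF assms, of i] lift_decode[OF assms, of j] by auto
    then have "i mod n = j mod n"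
      using bij decode_less ij by (auto simp: bij_betw_def dest!: inj_onD)
    with d show "i = j" by (rule encode_eqI)
  qed
  moreover have "lift \<gamma> ` {..<N} \<subseteq> {..<N}" using lift_decode(3)[OF assms] by auto
  ultimately have "bij_betw (lift \<gamma>) {..<N} {..<N}"
    by (simp add: bij_betw_def endo_inj_surj)
  then show ?thesis by (simp add: Bij_def lift_def)
qed

lemma lift_hom: "group_hom (BijGroup {..<n}) (BijGroup {..<N}) lift"
  by (intro group_hom.intro group_hom_axioms.intro group_BijGroup homI)
    (auto simp: BijGroup_def lift_Bij lift_compose compose_Bij)

lemma lift_inj: "inj_on lift (Bij {..<n})"
proof (rule inj_onI)
  fix \<gamma> \<gamma>' assume *: "\<gamma> \<in> Bij {..<n}" "\<gamma>' \<in> Bij {..<n}" "lift \<gamma> = lift \<gamma>'"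
  then have "\<gamma> x = \<gamma>' x" if "x < n" for x using lift_low[OF that] by metis
  with * show "\<gamma> = \<gamma>'"
    by (intro extensionalityI[of _ "{..<n}"]) (auto simp: Bij_def)
qed

text \<open>Multiplicativity of the lift splits into the two coordinates of a product. For the
  forward direction it suffices to multiply pairs with first coordinate 0, since these already
  realise all x and y.\<close>

lemma lift_iso_iff:
  assumes "\<gamma> \<in> Bij {..<n}"
  shows "lift \<gamma> \<in> iso (table_group G) (table_group G) \<longleftrightarrow> \<gamma> \<in> isoms"
proof
  assume "lift \<gamma> \<in> iso (table_group G) (table_group G)"
  then have hom: "lift \<gamma> (G ! i ! j) = G ! (lift \<gamma> i) ! (lift \<gamma> j)" if "i < N" "j < N" for i j
    using that hom_mult[of "lift \<gamma>" "table_group G" "table_group G" i j]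
    by (simp add: iso_def length_G)
  have "\<gamma> (B ! x ! y) = B ! \<gamma> x ! \<gamma> y \<and> f ! x ! y = f ! \<gamma> x ! \<gamma> y" if xy: "x < n" "y < n" for x y
  proof -
    have N: "x < N" "y < N" using xy by (simp_all add: less_N)
    note g = Bij_less[OF assms xy(1)] Bij_less[OF assms xy(2)]
    have gN: "\<gamma> x < N" "\<gamma> y < N" using g by (simp_all add: less_N)
    have eq: "lift \<gamma> (G ! x ! y) = G ! \<gamma> x ! \<gamma> y" using hom[OF N] lift_low xy by simp
    have "lift \<gamma> (G ! x ! y) mod n = \<gamma> (B ! x ! y)"
      using lift_decode[OF assms G_decode(3)[OF N]] G_decode[OF N] xy by simp
    moreover have "(G ! \<gamma> x ! \<gamma> y) mod n = B ! \<gamma> x ! \<gamma> y" using G_decode[OF gN] g by simp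
    \<comment> \<open>The element 0 of A need not be its unit, so a factor \<open>A ! 0 ! 0\<close>
      appears on both sides and is cancelled at the end.\<close>
    moreover have "lift \<gamma> (G ! x ! y) div n = A ! (A ! 0 ! 0) ! (f ! x ! y)"
      using lift_decode[OF assms G_decode(3)[OF N]] G_decode[OF N] xy by simp
    moreover have "(G ! \<gamma> x ! \<gamma> y) div n = A ! (A ! 0 ! 0) ! (f ! \<gamma> x ! \<gamma> y)" using G_decode[OF gN] g by simp
    ultimately show ?thesis
      using eq A.Units_l_cancel[of "A ! 0 ! 0" "f ! x ! y" "f ! \<gamma> x ! \<gamma> y"] A_closed[OF m_pos m_pos] f_closed xy g
      by (simp add: A.Units_eq)
  qed
  then show "\<gamma> \<in> isoms"
    using assms Bij_less[OF assms] by (auto simp: isometries_def auto_def intro!: homI)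
next
  assume \<gamma>: "\<gamma> \<in> isoms"
  have hom: "\<gamma> (B ! x ! y) = B ! \<gamma> x ! \<gamma> y" and f: "f ! \<gamma> x ! \<gamma> y = f ! x ! y" if "x < n" "y < n" for x y
    using \<gamma> that hom_mult[of \<gamma> GB GB x y] by (auto simp: isometries_def auto_def)
  have "lift \<gamma> (G ! i ! j) = G ! (lift \<gamma> i) ! (lift \<gamma> j)" if ij: "i < N" "j < N" for i j
  proof (rule encode_eqI)
    note d = decode_less[OF ij(1)] decode_less[OF ij(2)]
    note l = lift_decode[OF assms ij(1)] lift_decode[OF assms ij(2)]
    note g = lift_decode[OF assms G_decode(3)[OF ij]] G_decode[OF ij] G_decode[OF l(3,6)]
    show "lift \<gamma> (G ! i ! j) div n = G ! lift \<gamma> i ! lift \<gamma> j div n"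
      using d by (simp only: l g f)
    show "lift \<gamma> (G ! i ! j) mod n = G ! lift \<gamma> i ! lift \<gamma> j mod n"
      using d by (simp only: l g hom)
  qed
  then have "lift \<gamma> \<in> hom (table_group G) (table_group G)"
    using lift_decode(3)[OF assms] by (intro homI) (simp_all add: length_G)
  then show "lift \<gamma> \<in> iso (table_group G) (table_group G)"
    using lift_Bij[OF assms] by (simp add: iso_def length_G Bij_def)
qed

lemma list_fun_swap_list:
  assumes "i < n - 1"
  shows "list_fun (swap_list m n i) = lift (restrict (Transposition.transpose 0 (Suc i)) {..<n})"
  using decode_less by (auto simp: list_fun_def lift_def swap_list_def fun_eq_iff)

end

section \<open>Generators of the symmetric group\<close>

lemma swap_Bij: "a < k \<Longrightarrow> b < k \<Longrightarrow> restrict (Transposition.transpose a b) {..<k} \<in> Bij {..<k}"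
  using permutes_imp_bij[OF permutes_swap_id[of a "{..<k}" b]] by (simp add: Bij_def)

text \<open>Every transposition (a b) is the conjugate of (0 b) by (0 a), and transpositions
  generate all finite permutations. The restrictions are there because members of \<open>Bij\<close>
  are undefined outside the set.\<close>

lemma star_transpositions_generate:
  "generate (BijGroup {..<k}) ((\<lambda>i. restrict (Transposition.transpose 0 (Suc i)) {..<k}) ` {..<k - 1})
     = Bij {..<k}" (is "generate ?S ?X = _")
proof -
  interpret S: group ?S by (rule group_BijGroup)
  let ?t = "\<lambda>a b. restrict (Transposition.transpose a b) {..<k}"
  have X: "?X \<subseteq> carrier ?S" by (auto simp: BijGroup_def intro!: swap_Bij)
  have sub: "subgroup (generate ?S ?X) ?S" by (rule S.generate_is_subgroup[OF X])
  have mult: "compose {..<k} g h \<in> generate ?S ?X"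
    if "g \<in> generate ?S ?X" "h \<in> generate ?S ?X" for g h
  proof -
    have "g \<in> Bij {..<k}" "h \<in> Bij {..<k}"
      using that subgroup.subset[OF sub] by (auto simp: BijGroup_def)
    then have "g \<otimes>\<^bsub>?S\<^esub> h = compose {..<k} g h" by (simp add: BijGroup_def)
    then show ?thesis using subgroup.m_closed[OF sub that] by simp
  qed
  have one: "restrict id {..<k} \<in> generate ?S ?X"
    using subgroup.one_closed[OF sub] by (simp add: BijGroup_def id_def)
  have star: "?t 0 a \<in> generate ?S ?X" if "a < k" for a
  proof (cases a)
    case 0
    then show ?thesis using one by simp
  next
    case (Suc i)
    with that show ?thesis by (intro generate.incl) auto
  qed
  have trans: "?t a b \<in> generate ?S ?X" if "a < k" "b < k" "a \<noteq> b" for a b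
  proof -
    consider "a = 0" | "b = 0" | "a \<noteq> 0" "b \<noteq> 0" by blast
    then show ?thesis
    proof cases
      case 1
      then show ?thesis using star that by simp
    next
      case 2
      then show ?thesis using star that by (simp add: transpose_commute[of a 0])
    next
      case 3
      let ?r = "Transposition.transpose 0 :: nat \<Rightarrow> nat \<Rightarrow> nat"
      have "Transposition.transpose a b x = ?r a (?r b (?r a x))" for x
        using 3 that(3) unfolding Transposition.transpose_def by presburger
      moreover have "?r c x < k" if "c < k" "x < k" for c x
        using that by (simp add: Transposition.transpose_def)
      ultimately have "?t a b = compose {..<k} (?t 0 a) (compose {..<k} (?t 0 b) (?t 0 a))"
        using that(1,2) by (simp add: fun_eq_iff compose_def)
      then show ?thesis using mult star that by simp
    qed
  qed
  have perm: "restrict p {..<k} \<in> generate ?S ?X" if "p permutes {..<k}" for p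
    using that finite_lessThan
  proof (induction rule: permutes_induct)
    case id
    then show ?case by (rule one)
  next
    case (swap a b p)
    have *: "restrict (Transposition.transpose a b \<circ> p) {..<k} = compose {..<k} (?t a b) (restrict p {..<k})"
      using permutes_in_image[OF swap.hyps(4)] by (auto simp: fun_eq_iff compose_def)
    show ?case unfolding * by (intro mult trans swap.IH) (use swap.hyps in auto)
  qed
  show ?thesis
  proof
    show "generate ?S ?X \<subseteq> Bij {..<k}"
      using subgroup.subset[OF sub] by (simp add: BijGroup_def)
    show "Bij {..<k} \<subseteq> generate ?S ?X"
    proof
      fix g assume g: "g \<in> Bij {..<k}"
      \<comment> \<open>Maps in the sense of \<open>permutes\<close> are the identity outside the
        set, so g is extended by the identity; restricting gives g back.\<close>
      let ?p = "\<lambda>x. if x < k then g x else x"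
      have "?p permutes {..<k}"
        using g bij_betw_cong[of "{..<k}" ?p g] by (intro bij_imp_permutes) (simp_all add: Bij_def)
      moreover have "restrict ?p {..<k} = g"
        using g by (auto simp: Bij_def extensional_def fun_eq_iff)
      ultimately show "g \<in> generate ?S ?X" using perm[of ?p] by (simp only:)
    qed
  qed
qed

section \<open>Correctness of the two maps of the reduction\<close>

context bi_instance
begin

abbreviation "swaps \<equiv> map (swap_list m n) [0..<n - 1]"

text \<open>A homomorphism carries generators of a group to generators of its image.\<close>

lemma generated_swaps: "generated_perms N swaps = lift ` Bij {..<n}"
proof -
  interpret group_hom "BijGroup {..<n}" "BijGroup {..<N}" lift by (rule lift_hom)
  let ?X = "(\<lambda>i. restrict (Transposition.transpose 0 (Suc i)) {..<n}) ` {..<n - 1}"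
  have "list_fun ` set swaps = lift ` ?X"
    by (auto simp: image_image list_fun_swap_list atLeast0LessThan intro!: image_cong)
  moreover have "?X \<subseteq> carrier (BijGroup {..<n})" by (auto simp: BijGroup_def intro!: swap_Bij)
  ultimately show ?thesis
    by (simp only: generated_perms_def generate_img star_transpositions_generate)
qed

lemma list_coset_id:
  assumes "\<And>g. g \<in> generated_perms N ps \<Longrightarrow> g \<in> Bij {..<N}"
  shows "list_coset N [0..<N] ps = generated_perms N ps"
proof -
  have "compose {..<N} (list_fun [0..<N]) g = g" if "g \<in> Bij {..<N}" for g
  proof
    fix i show "compose {..<N} (list_fun [0..<N]) g i = g i"
      using that Bij_less[OF that, of i] by (auto simp: compose_def list_fun_def Bij_def extensional_def)
  qed
  then show ?thesis using assms by (force simp: list_coset_def)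
qed

lemma forward_instance: "forward (A, B, f) \<in> GRIS_instances"
proof -
  have "list_fun [0..<N] = restrict id {..<N}" by (auto simp: list_fun_def)
  then have "bij_betw (list_fun [0..<N]) {..<N} {..<N}" by simp
  moreover have "is_perm_list N (swap_list m n i)" if "i < n - 1" for i
    using lift_Bij[OF swap_Bij[of 0 n "Suc i"]] that n_pos
    by (simp add: is_perm_list_def list_fun_swap_list) (simp add: swap_list_def)
  ultimately show ?thesis
    by (auto simp: forward_def Let_def GRIS_instances_def group_table_G length_G)
qed

lemma iso_coset:
  "iso (table_group G) (table_group G) \<inter> list_coset N [0..<N] swaps = lift ` isoms"
proof -
  have sub: "isoms \<subseteq> Bij {..<n}" by (auto simp: isometries_def auto_def)
  have "g \<in> Bij {..<N}" if "g \<in> generated_perms N swaps" for g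
    using that unfolding generated_swaps by (auto simp: lift_Bij)
  from list_coset_id[of swaps, OF this]
  have coset: "list_coset N [0..<N] swaps = lift ` Bij {..<n}" unfolding generated_swaps .
  show ?thesis unfolding coset
  proof (intro equalityI subsetI)
    fix h assume "h \<in> iso (table_group G) (table_group G) \<inter> lift ` Bij {..<n}"
    then obtain \<gamma> where \<gamma>: "\<gamma> \<in> Bij {..<n}" "h = lift \<gamma>"
      and "lift \<gamma> \<in> iso (table_group G) (table_group G)" by auto
    then have "\<gamma> \<in> isoms" by (simp only: lift_iso_iff)
    with \<gamma> show "h \<in> lift ` isoms" by (intro image_eqI)
  next
    fix h assume "h \<in> lift ` isoms"
    then obtain \<gamma> where \<gamma>: "\<gamma> \<in> isoms" "h = lift \<gamma>" by (rule imageE)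
    then have "\<gamma> \<in> Bij {..<n}" by (intro subsetD[OF sub])
    with \<gamma> show "h \<in> iso (table_group G) (table_group G) \<inter> lift ` Bij {..<n}"
      using lift_iso_iff[of \<gamma>] by (intro IntI image_eqI) (simp_all only:)
  qed
qed

text \<open>\<open>BI_solutions_nonempty\<close> provides generators of the isometries, and whatever
  is generated is a subgroup.\<close>

lemma isoms_subgroup: "subgroup isoms (BijGroup {..<n})"
proof -
  obtain ps where "\<forall>p\<in>set ps. is_perm_list n p" "generated_perms n ps = isoms"
    using BI_solutions_nonempty[OF inst] by (auto simp: BI_solutions_def)
  moreover from this have "list_fun ` set ps \<subseteq> carrier (BijGroup {..<n})"
    by (auto simp: BijGroup_def is_perm_list_def)
  ultimately show ?thesis
    using group.generate_is_subgroup[OF group_BijGroup] by (metis generated_perms_def)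
qed

lemma forward_solution:
  assumes "s \<in> GRIS_solutions (forward (A, B, f))"
  obtains t qs where "s = Some (t, qs)" "\<And>q. q \<in> set (t # qs) \<Longrightarrow> length q = N"
    "generate (BijGroup {..<N}) (list_fun ` set (t # qs)) = lift ` isoms"
proof -
  interpret L: group_hom "BijGroup {..<n}" "BijGroup {..<N}" lift by (rule lift_hom)
  let ?S = "BijGroup {..<N}"
  have sub: "subgroup (lift ` isoms) ?S" by (rule L.subgroup_img_is_subgroup[OF isoms_subgroup])
  \<comment> \<open>The identity is an isometry, so the answer \<open>None\<close> is ruled
    out.\<close>
  have "lift ` isoms \<noteq> {}" using subgroup.one_closed[OF isoms_subgroup] by auto
  with assms obtain t qs where s: "s = Some (t, qs)" and t: "length t = N"
    and qs: "\<And>q. q \<in> set qs \<Longrightarrow> is_perm_list N q" and coset: "list_coset N t qs = lift ` isoms"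
    by (auto simp: forward_def GRIS_solutions_def Let_def length_G iso_coset simp del: One_nat_def split: if_splits)
  define Q where "Q = generate ?S (list_fun ` set qs)"
  have cQ: "compose {..<N} (list_fun t) ` Q = lift ` isoms"
    using coset by (simp add: list_coset_def generated_perms_def Q_def)
  have qsB: "list_fun ` set qs \<subseteq> carrier ?S"
    using qs by (auto simp: BijGroup_def is_perm_list_def)
  then have Q: "subgroup Q ?S" unfolding Q_def by (rule L.H.generate_is_subgroup)
  \<comment> \<open>The identity belongs to the group generated by \<open>qs\<close>, so t lies in
    its own coset and is the lift of an isometry.\<close>
  have "compose {..<N} (list_fun t) \<one>\<^bsub>?S\<^esub> = list_fun t"
    using t by (auto simp: BijGroup_def compose_def list_fun_def fun_eq_iff)
  then have tI: "list_fun t \<in> lift ` isoms"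
    using cQ subgroup.one_closed[OF Q] by (metis imageI)
  have tB: "list_fun t \<in> carrier ?S" using subgroup.subset[OF sub] tI by blast
  have mult: "list_fun t \<otimes>\<^bsub>?S\<^esub> g = compose {..<N} (list_fun t) g" if "g \<in> Q" for g
    using tB subgroup.subset[OF Q] that by (auto simp: BijGroup_def)
  have tQ: "list_fun t \<otimes>\<^bsub>?S\<^esub> g \<in> lift ` isoms" if "g \<in> Q" for g
    using mult[OF that] cQ that by auto
  have "generate ?S (list_fun ` set (t # qs)) \<subseteq> lift ` isoms"
  proof (rule L.H.generate_subgroup_incl[OF _ sub])
    have "g \<in> lift ` isoms" if "g \<in> Q" for g
    proof -
      \<comment> \<open>Each g in the group generated by \<open>qs\<close> is the product of the
        inverse of t and t g, both of which lie in the subgroup of lifted isometries.\<close>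
      have "inv\<^bsub>?S\<^esub> (list_fun t) \<otimes>\<^bsub>?S\<^esub> (list_fun t \<otimes>\<^bsub>?S\<^esub> g) \<in> lift ` isoms"
        by (rule subgroup.m_closed[OF sub subgroup.m_inv_closed[OF sub tI] tQ[OF that]])
      moreover have "g \<in> carrier ?S" using subgroup.subset[OF Q] that by blast
      then have "inv\<^bsub>?S\<^esub> (list_fun t) \<otimes>\<^bsub>?S\<^esub> (list_fun t \<otimes>\<^bsub>?S\<^esub> g) = g"
        using tB by (simp add: L.H.m_assoc[symmetric])
      ultimately show ?thesis by simp
    qed
    then show "list_fun ` set (t # qs) \<subseteq> lift ` isoms"
      using tI generate.incl[of _ "list_fun ` set qs" ?S] by (auto simp: Q_def)
  qed
  moreover have "lift ` isoms \<subseteq> generate ?S (list_fun ` set (t # qs))"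
  proof
    fix h assume "h \<in> lift ` isoms"
    then obtain g where g: "g \<in> Q" "h = list_fun t \<otimes>\<^bsub>?S\<^esub> g" using cQ mult by auto
    have "Q \<subseteq> generate ?S (list_fun ` set (t # qs))"
      unfolding Q_def by (rule L.H.mono_generate) auto
    then have "g \<in> generate ?S (list_fun ` set (t # qs))" using g(1) by blast
    moreover have "list_fun t \<in> generate ?S (list_fun ` set (t # qs))" by (rule generate.incl) simp
    ultimately show "h \<in> generate ?S (list_fun ` set (t # qs))"
      unfolding g(2) by (rule generate.eng[rotated])
  qed
  moreover have "length q = N" if "q \<in> set (t # qs)" for q
    using that t qs by (auto simp: is_perm_list_def)
  ultimately show thesis using s that by blast
qed

text \<open>Truncation inverts \<open>lift\<close> on each generator. As \<open>lift\<close> is an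
  injective homomorphism, equality of the generated group with the isometries can be checked after
  lifting, where it is the assumption \<open>gen\<close>.\<close>

lemma backward_solution:
  assumes "\<And>q. q \<in> set qs \<Longrightarrow> length q = N"
    and gen: "generate (BijGroup {..<N}) (list_fun ` set qs) = lift ` isoms"
  shows "map (take n) qs \<in> BI_solutions (A, B, f)"
proof -
  interpret L: group_hom "BijGroup {..<n}" "BijGroup {..<N}" lift by (rule lift_hom)
  have isomsB: "isoms \<subseteq> Bij {..<n}" by (auto simp: isometries_def auto_def)
  have take: "list_fun (take n q) \<in> isoms \<and> lift (list_fun (take n q)) = list_fun q \<and> length (take n q) = n"
    if q: "q \<in> set qs" for q
  proof -
    have "list_fun q \<in> lift ` isoms" using gen q generate.incl[of "list_fun q"] by blast
    then obtain \<gamma> where \<gamma>: "\<gamma> \<in> isoms" "list_fun q = lift \<gamma>" by blast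
    have "list_fun (take n q) x = \<gamma> x" for x
    proof (cases "x < n")
      case True
      then have "q ! x = list_fun q x" using assms(1)[OF q] less_N by (simp add: list_fun_def)
      also have "\<dots> = \<gamma> x" using \<gamma>(2) lift_low[OF True] by simp
      finally show ?thesis
        using True assms(1)[OF q] less_N[OF True] by (simp add: list_fun_def)
    next
      case False
      then show ?thesis using \<gamma>(1) isomsB by (auto simp: list_fun_def Bij_def extensional_def)
    qed
    then have "list_fun (take n q) = \<gamma>" by blast
    moreover have "n \<le> N" using m_pos by (cases m) simp_all
    ultimately show ?thesis using \<gamma> assms(1)[OF q] by simp
  qed
  let ?X = "list_fun ` set (map (take n) qs)"
  have X: "?X \<subseteq> isoms" using take by auto
  then have XB: "?X \<subseteq> carrier (BijGroup {..<n})" using isomsB by (auto simp: BijGroup_def)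
  have "lift ` generate (BijGroup {..<n}) ?X = generate (BijGroup {..<N}) (lift ` ?X)"
    using L.generate_img[OF XB] by simp
  also have "lift ` ?X = list_fun ` set qs"
    using take by (simp add: image_image)
  finally have "lift ` generate (BijGroup {..<n}) ?X = lift ` isoms" using gen by simp
  moreover have "generate (BijGroup {..<n}) ?X \<subseteq> Bij {..<n}"
    using L.G.generate_incl[OF XB] by (simp add: BijGroup_def)
  ultimately have "generate (BijGroup {..<n}) ?X = isoms"
    using inj_on_image_eq_iff[OF lift_inj] isomsB by blast
  then show ?thesis
    using take isomsB by (auto simp: BI_solutions_def generated_perms_def is_perm_list_def)
qed

lemma tables_ok: "tables_ok [A, B, f]"
proof -
  have "is_group_table A" "is_group_table B" "length f = n" "\<forall>r\<in>set f. length r = n"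
    using inst by (simp_all add: BI_instances_def)
  moreover from this have "is_matrix n n m f"
    using f_closed by (simp add: is_matrix_def)
  ultimately show ?thesis
    using n_pos group_table_is_matrix unfolding tables_ok_def by blast
qed

end

text \<open>The value for \<open>None\<close> is a mere default: by \<open>forward_solution\<close>
  this answer is not a solution of any instance in the image of \<open>forward\<close> on BI
  instances.\<close>

definition backward :: "bi_inst \<times> (nat list \<times> nat list list) option \<Rightarrow> nat list list" where
  "backward = (\<lambda>((A, B, f), s). case s of None \<Rightarrow> [] | Some (t, qs) \<Rightarrow> map (take (length B)) (t # qs))"

theorem theorem3:
  shows "poly_many_one_reducible BI GRIS"
  unfolding poly_many_one_reducible_def
proof (intro exI[of _ forward] exI[of _ backward] conjI ballI)
  show "polytime_on (enc_inst BI) (enc_inst GRIS) (instances BI) forward"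
  proof (rule polytime_on_emits[OF emits_forward])
    fix x assume "x \<in> instances BI"
    then obtain A B f where x: "x = (A, B, f)" "bi_instance A B f"
      by (cases x) (auto simp: BI_def bi_instance_def)
    then show "\<exists>Ts. enc_inst BI x = enc_tables Ts \<and> forward_pre Ts (\<lambda>_. 0) \<and>
        enc_inst GRIS (forward (Ts ! 0, Ts ! 1, Ts ! 2)) = enc_inst GRIS (forward x)"
      using bi_instance.tables_ok[OF x(2)]
      by (intro exI[of _ "[A, B, f]"]) (simp add: BI_def enc_pair_def Let_def enc_tables_def forward_pre_def)
  qed
next
  show "polytime_on (enc_pair (enc_inst BI) (enc_sol GRIS)) (enc_sol BI)
      {(x, s). x \<in> instances BI \<and> s \<in> solutions GRIS (forward x)} backward"
  proof (rule polytime_on_emits[OF emits_backward])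
    fix xs assume "xs \<in> {(x, s). x \<in> instances BI \<and> s \<in> solutions GRIS (forward x)}"
    then obtain A B f s where xs: "xs = ((A, B, f), s)" and bi: "bi_instance A B f"
      and s: "s \<in> GRIS_solutions (forward (A, B, f))"
      by (auto simp: BI_def GRIS_def bi_instance_def)
    obtain t qs where s: "s = Some (t, qs)"
      and len: "\<And>q. q \<in> set (t # qs) \<Longrightarrow> length q = length A * length B"
      using bi_instance.forward_solution[OF bi s] by blast
    let ?Ts = "[A, B, f, t # qs]"
    have "length B \<le> length A * length B"
      using bi_instance.m_pos[OF bi] by (cases A) auto
    then have "backward_pre ?Ts (\<lambda>_. 0)"
      using len nth_mem[of _ "t # qs"] by (simp add: backward_pre_def del: set_simps nth_Cons_Suc)
    moreover have "enc_pair (enc_inst BI) (enc_sol GRIS) xs = enc_tables ?Ts"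
      by (simp add: xs s BI_def GRIS_def enc_pair_def Let_def enc_tables_def)
    moreover have "enc_table (map (take (length (?Ts ! 1))) (?Ts ! 3)) = enc_sol BI (backward xs)"
      by (simp add: xs s BI_def backward_def)
    ultimately show "\<exists>Ts. enc_pair (enc_inst BI) (enc_sol GRIS) xs = enc_tables Ts \<and> backward_pre Ts (\<lambda>_. 0) \<and>
        enc_table (map (take (length (Ts ! 1))) (Ts ! 3)) = enc_sol BI (backward xs)"
      by blast
  qed
next
  fix x assume "x \<in> instances BI"
  then obtain A B f where x: "x = (A, B, f)" and bi: "bi_instance A B f"
    by (cases x) (auto simp: BI_def bi_instance_def)
  show "forward x \<in> instances GRIS"
    using bi_instance.forward_instance[OF bi] by (simp add: GRIS_def x)
  fix s assume "s \<in> solutions GRIS (forward x)"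
  then have "s \<in> GRIS_solutions (forward (A, B, f))" by (simp add: GRIS_def x)
  from bi_instance.forward_solution[OF bi this] obtain t qs where "s = Some (t, qs)"
    "map (take (length B)) (t # qs) \<in> BI_solutions (A, B, f)"
    using bi_instance.backward_solution[OF bi] by metis
  then show "backward (x, s) \<in> solutions BI x" by (simp add: BI_def backward_def x)
qed

end
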